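(* Let $T$ and $T'$ be ptableaux. Then $T$ and $T'$ are plactically equivalent if and only if their duals $\widehat T$ and $\widehat{T'}$ lie in the same irreducible crystal graph.
   Context: Ptableaux. A perforated tableau (ptableau) with $n$ rows is a rectangular array with $n$ rows (numbered from top), each box either a cell containing a positive integer (its content) or blank, such that: (a) for each $i$ the cells with content $i$ form a horizontal strip; (b) if $i<j$, no cell with content $j$ lies in a row strictly above, or a column strictly to the left of, any cell with content $i$; (c) the number of columns is minimal subject to (a),(b) (entirely blank rows are allowed). Ptableaux are identified up to row-equivalence (swaps of a blank with an adjacent cell in the same row, each producing a ptableau); a ptableau is determined by the multiset of (content,row) pairs of its cells. Crystal: for $1\le i<n$, $T[i,i+1]$ is formed by rows $i,i+1$ (all-blank columns removed). $e_i(T)$ moves to row $i$ the cell of $T$ corresponding to the rightmost cell of row $i+1$ of the left-justified form of $T[i,i+1]$ having a blank directly above it ($\mathrm{NULL}$ if none); $f_i(T)$ moves to row $i+1$ the cell corresponding to the leftmost cell of row $i$ of the right-justified form of $T[i,i+1]$ having a blank directly below it ($\mathrm{NULL}$ if none). This makes ptableaux with $n$ rows a type $A_{n-1}$ crystal; irreducible crystal graphs are its connected components. $T$ and $T'$ (with the same number of rows) are plactically equivalent if some isomorphism of crystal graphs from the component of $T$ to the component of $T'$ sends $T$ to $T'$. Dual: $\widehat T$ has a cell of content $j$ in row $i$ for each cell of $T$ of content $i$ in row $j$ (the duals are regarded as ptableaux with a common number of rows, at least the largest content occurring).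
   Formalization: Condition (b) is read as: no larger content lies weakly above and weakly left of a smaller one (literally, f_1 of the row 1 2 would not be a ptableau); isomorphisms of crystal graphs must preserve weight (row counts), else for n=1 a single cell would be equivalent to the empty ptableau. *)

theory Defs
  imports Main "HOL-Library.Multiset"
begin

text \<open>Arrays of boxes. Rows and columns are numbered from 1, row 1 on top; a box is blank
  (\<open>None\<close>) or a cell with a content (\<open>Some j\<close>). The number of rows is a parameter of
  the predicates below, the number of columns is stored in the array.\<close>

datatype parray = PArray (ncols: nat) (box: "nat \<Rightarrow> nat \<Rightarrow> nat option")

definition horizontal_strip :: "(nat \<times> nat) set \<Rightarrow> bool" where
  "horizontal_strip S \<longleftrightarrow>
     (\<forall>r c r' c'. (r, c) \<in> S \<longrightarrow> (r', c') \<in> S \<longrightarrow> r < r' \<longrightarrow> c' < c)"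

text \<open>As in a skew diagram: no two boxes of a horizontal strip share a column, and the strip
  runs from the lower left to the upper right.

  In the second condition below, a larger content must not be northwest of a smaller one. The
  comparison is weak in both directions; as the two boxes are distinct, it is strict in at least
  one of them. Comparing rows alone, or columns alone, would already exclude ordinary
  semistandard tableaux (columns) and would not be preserved by the crystal operators (rows).\<close>

definition filling :: "nat \<Rightarrow> parray \<Rightarrow> bool" where
  "filling n A \<longleftrightarrow>
     (\<forall>r c j. box A r c = Some j \<longrightarrow> 1 \<le> r \<and> r \<le> n \<and> 1 \<le> c \<and> c \<le> ncols A \<and> 1 \<le> j) \<and>
     (\<forall>i. horizontal_strip {(r, c). box A r c = Some i}) \<and>
     (\<forall>i j r c r' c'. i < j \<longrightarrow> box A r c = Some i \<longrightarrow> box A r' c' = Some j \<longrightarrow>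
        \<not> (r' \<le> r \<and> c' \<le> c))"

definition array_cells :: "parray \<Rightarrow> (nat \<times> nat) multiset" where
  "array_cells A =
     image_mset (\<lambda>(r, c). (the (box A r c), r)) (mset_set {(r, c). box A r c \<noteq> None})"

text \<open>The pairs in \<open>array_cells\<close> are (content, row).\<close>

definition ptableau_array :: "nat \<Rightarrow> parray \<Rightarrow> bool" where
  "ptableau_array n A \<longleftrightarrow> filling n A \<and>
     (\<forall>B. filling n B \<longrightarrow> array_cells B = array_cells A \<longrightarrow> ncols A \<le> ncols B)"

definition shift_cell :: "parray \<Rightarrow> nat \<Rightarrow> nat \<Rightarrow> nat \<Rightarrow> parray" where
  "shift_cell A r c c' =
     PArray (ncols A) ((box A)(r := (box A r)(c := None, c' := box A r c)))"

text \<open>Swap of a blank with an adjacent cell of the same row. It changes neither the number of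
  columns nor \<open>array_cells\<close>, so a swap of a \<open>ptableau_array\<close> that gives a \<open>filling\<close> gives a
  \<open>ptableau_array\<close>.\<close>

definition swap_step :: "nat \<Rightarrow> parray \<Rightarrow> parray \<Rightarrow> bool" where
  "swap_step n A B \<longleftrightarrow> filling n A \<and> filling n B \<and>
     (\<exists>r c c'. (c' = Suc c \<or> c = Suc c') \<and> box A r c \<noteq> None \<and> box A r c' = None \<and>
        B = shift_cell A r c c')"

definition row_equiv :: "nat \<Rightarrow> (parray \<times> parray) set" where
  "row_equiv n =
     {(A, B). ptableau_array n A \<and> ptableau_array n B \<and> (swap_step n)\<^sup>*\<^sup>* A B}"

type_synonym ptableau = "parray set"

definition ptableaux :: "nat \<Rightarrow> ptableau set" where
  "ptableaux n = {A. ptableau_array n A} // row_equiv n"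

definition cells :: "ptableau \<Rightarrow> (nat \<times> nat) multiset" where
  "cells T = the_elem (array_cells ` T)"

definition contents :: "ptableau \<Rightarrow> nat set" where
  "contents T = fst ` set_mset (cells T)"

definition ptableau_of_cells :: "nat \<Rightarrow> (nat \<times> nat) multiset \<Rightarrow> ptableau" where
  "ptableau_of_cells n M = (THE T. T \<in> ptableaux n \<and> cells T = M)"

text \<open>The two-row array \<open>T[i, i+1]\<close>; rows \<open>i\<close> and \<open>i + 1\<close> become rows 1 and 2.\<close>

definition nonblank_columns :: "nat \<Rightarrow> parray \<Rightarrow> nat set" where
  "nonblank_columns i A = {c. box A i c \<noteq> None \<or> box A (Suc i) c \<noteq> None}"

definition two_rows :: "nat \<Rightarrow> parray \<Rightarrow> parray" where
  "two_rows i A =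
     (let cs = sorted_list_of_set (nonblank_columns i A)
      in PArray (length cs)
           (\<lambda>r k. if (r = 1 \<or> r = 2) \<and> 1 \<le> k \<and> k \<le> length cs
                  then box A (i + r - 1) (cs ! (k - 1)) else None))"

text \<open>Justified forms are not required to have all columns nonblank: \<open>T[i, i+1]\<close> need not have
  the minimal number of columns even though its blank columns are removed, and justifying it may
  then empty columns at one end.\<close>

definition left_justified_form :: "nat \<Rightarrow> parray \<Rightarrow> parray \<Rightarrow> bool" where
  "left_justified_form n A L \<longleftrightarrow> (swap_step n)\<^sup>*\<^sup>* A L \<and>
     (\<forall>r c. box L r (Suc c) \<noteq> None \<longrightarrow> box L r c = None \<longrightarrow>
        \<not> filling n (shift_cell L r (Suc c) c))"

definition right_justified_form :: "nat \<Rightarrow> parray \<Rightarrow> parray \<Rightarrow> bool" where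
  "right_justified_form n A R \<longleftrightarrow> (swap_step n)\<^sup>*\<^sup>* A R \<and>
     (\<forall>r c. box R r c \<noteq> None \<longrightarrow> box R r (Suc c) = None \<longrightarrow>
        \<not> filling n (shift_cell R r c (Suc c)))"

text \<open>\<open>raising_content i T j\<close>: the cell of \<open>T\<close> moved by \<open>e\<^sub>i\<close> exists and has content \<open>j\<close>;
  likewise \<open>lowering_content\<close> for \<open>f\<^sub>i\<close>. Content and row of the moved cell determine the result,
  as a ptableau is determined by its (content, row) pairs.\<close>

definition raising_content :: "nat \<Rightarrow> ptableau \<Rightarrow> nat \<Rightarrow> bool" where
  "raising_content i T j \<longleftrightarrow>
     (\<exists>A\<in>T. \<exists>L k. left_justified_form 2 (two_rows i A) L \<and>
        box L 2 k = Some j \<and> box L 1 k = None \<and>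
        (\<forall>k'>k. box L 2 k' \<noteq> None \<longrightarrow> box L 1 k' \<noteq> None))"

definition lowering_content :: "nat \<Rightarrow> ptableau \<Rightarrow> nat \<Rightarrow> bool" where
  "lowering_content i T j \<longleftrightarrow>
     (\<exists>A\<in>T. \<exists>R k. right_justified_form 2 (two_rows i A) R \<and>
        box R 1 k = Some j \<and> box R 2 k = None \<and>
        (\<forall>k'<k. box R 1 k' \<noteq> None \<longrightarrow> box R 2 k' \<noteq> None))"

definition e_op :: "nat \<Rightarrow> nat \<Rightarrow> ptableau \<Rightarrow> ptableau option" where
  "e_op n i T =
     (if \<exists>j. raising_content i T j
      then let j = (THE j. raising_content i T j)
           in Some (ptableau_of_cells n (cells T - {#(j, Suc i)#} + {#(j, i)#}))
      else None)"

definition f_op :: "nat \<Rightarrow> nat \<Rightarrow> ptableau \<Rightarrow> ptableau option" where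
  "f_op n i T =
     (if \<exists>j. lowering_content i T j
      then let j = (THE j. lowering_content i T j)
           in Some (ptableau_of_cells n (cells T - {#(j, i)#} + {#(j, Suc i)#}))
      else None)"

definition weight :: "ptableau \<Rightarrow> nat \<Rightarrow> nat" where
  "weight T r = size (filter_mset (\<lambda>p. snd p = r) (cells T))"

definition crystal_edge :: "nat \<Rightarrow> ptableau \<Rightarrow> ptableau \<Rightarrow> bool" where
  "crystal_edge n T U \<longleftrightarrow> T \<in> ptableaux n \<and> (\<exists>i. 1 \<le> i \<and> i < n \<and> f_op n i T = Some U)"

definition component :: "nat \<Rightarrow> ptableau \<Rightarrow> ptableau set" where
  "component n T = {U. (\<lambda>V W. crystal_edge n V W \<or> crystal_edge n W V)\<^sup>*\<^sup>* T U}"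

definition irreducible_crystals :: "nat \<Rightarrow> ptableau set set" where
  "irreducible_crystals n = component n ` ptableaux n"

text \<open>Isomorphisms of crystals preserve the weight, which is the vector in \<open>\<int>\<^sup>n\<close> of the numbers
  of cells in the rows. (As a weight modulo \<open>(1, \<dots>, 1)\<close>, or without the weight, the full
  column \<open>1, \<dots>, n\<close> would become equivalent to the empty ptableau.)\<close>

definition crystal_iso :: "nat \<Rightarrow> ptableau set \<Rightarrow> ptableau set \<Rightarrow> (ptableau \<Rightarrow> ptableau) \<Rightarrow> bool" where
  "crystal_iso n C D \<phi> \<longleftrightarrow> bij_betw \<phi> C D \<and>
     (\<forall>T\<in>C. (\<forall>r. 1 \<le> r \<and> r \<le> n \<longrightarrow> weight (\<phi> T) r = weight T r) \<and>
        (\<forall>i. 1 \<le> i \<and> i < n \<longrightarrow>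
           e_op n i (\<phi> T) = map_option \<phi> (e_op n i T) \<and>
           f_op n i (\<phi> T) = map_option \<phi> (f_op n i T)))"

definition plactically_equivalent :: "nat \<Rightarrow> ptableau \<Rightarrow> ptableau \<Rightarrow> bool" where
  "plactically_equivalent n T T' \<longleftrightarrow>
     (\<exists>\<phi>. crystal_iso n (component n T) (component n T') \<phi> \<and> \<phi> T = T')"

definition dual :: "nat \<Rightarrow> ptableau \<Rightarrow> ptableau" where
  "dual N T = ptableau_of_cells N (image_mset prod.swap (cells T))"

end

theory Submission
  imports Defs
begin

text \<open>A ptableau is the same thing as the matrix of multiplicities of its (content, row) pairs, and
  the dual is the transposed matrix. On matrices, the crystal operator for the rows \<open>i\<close>, \<open>i + 1\<close>
  acts at an extremal argmax of a balance of partial sums of the two rows. One compares the first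
  differences of the balances of a row pair and of a column pair: both contain the same difference
  of two matrix entries, and hence row operators and column operators commute. So a column operator
  is an isomorphism of crystals where it is defined. Conversely, an isomorphism carries a path that
  raises \<open>T\<close> to a highest weight element to such a path of \<open>T'\<close>; the two ends have the same weight,
  and raising them by column operators leads to matrices that are of highest weight for rows and
  columns. Such a matrix is diagonal, and is therefore determined by its weight.\<close>

section \<open>Crystal operators on multisets\<close>

text \<open>A cell of row \<open>i + 1\<close> with content \<open>y\<close> can be matched only
  with a cell of row \<open>i\<close> of content less than \<open>y\<close>. Hence the balance at
  \<open>t\<close> bounds the number of unmatched cells of row \<open>i + 1\<close> from below, as
  in Hall's theorem, and its maximum is that number. This is what turns the choice of a cell in a
  justified array, which speaks about columns, into a condition on multiplicities alone. The
  obstacle to commutation is the case in which the row move and the column move want the same cell: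
  the first argmax may then shift by one place. It does so under the same condition for rows and for
  columns. Isomorphisms are treated as relations that follow the crystal edges, because a single
  column step is such a relation on all ptableaux at once, and such relations can be inverted and
  composed along a path in the crystal of the duals.\<close>

definition valid :: "nat \<Rightarrow> (nat \<times> nat) multiset \<Rightarrow> bool" where
  "valid n M \<longleftrightarrow> (\<forall>(t, r) \<in># M. 1 \<le> t \<and> 1 \<le> r \<and> r \<le> n)"

definition row_size :: "nat \<Rightarrow> (nat \<times> nat) multiset \<Rightarrow> nat" where
  "row_size r M = size {#p \<in># M. snd p = r#}"

text \<open>The asymmetry between \<open>\<le>\<close> and \<open><\<close> reflects that contents
  increase strictly down a column.\<close>

definition balance :: "nat \<Rightarrow> (nat \<times> nat) multiset \<Rightarrow> nat \<Rightarrow> int" where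
  "balance i M t = int (size {#p \<in># M. snd p = Suc i \<and> fst p \<le> t#})
                 - int (size {#p \<in># M. snd p = i \<and> fst p < t#})"

text \<open>The first argmax. On valid multisets a maximum already attained at 0 means that no cell
  of row \<open>i + 1\<close> is unmatched, and then nothing can be raised; hence
  \<open>0 < t\<close>.\<close>

definition raises :: "nat \<Rightarrow> (nat \<times> nat) multiset \<Rightarrow> nat \<Rightarrow> bool" where
  "raises i M t \<longleftrightarrow> 0 < t \<and> (\<forall>s<t. balance i M s < balance i M t) \<and>
     (\<forall>s>t. balance i M s \<le> balance i M t)"

text \<open>The last argmax. There is none if the maximum is the eventual value of the balance, and
  then nothing can be lowered.\<close>

definition lowers :: "nat \<Rightarrow> (nat \<times> nat) multiset \<Rightarrow> nat \<Rightarrow> bool" where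
  "lowers i M t \<longleftrightarrow> (\<forall>s<t. balance i M s \<le> balance i M t) \<and>
     (\<forall>s>t. balance i M s < balance i M t)"

text \<open>A relation instead of a partial function: read backwards on valid multisets it is the
  lowering operator.\<close>

definition up :: "nat \<Rightarrow> (nat \<times> nat) multiset \<Rightarrow> (nat \<times> nat) multiset \<Rightarrow> bool" where
  "up i M K \<longleftrightarrow>
     (\<exists>t M0. M = add_mset (t, Suc i) M0 \<and> K = add_mset (t, i) M0 \<and> raises i M t)"

abbreviation swapped :: "(nat \<times> nat) multiset \<Rightarrow> (nat \<times> nat) multiset" where
  "swapped M \<equiv> image_mset prod.swap M"

lemma swapped_swapped [simp]: "swapped (swapped M) = M"
  by (simp add: multiset.map_comp)

lemma count_swapped [simp]: "count (swapped M) (a, b) = count M (b, a)"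
  by (induction M) auto

lemma valid_add_mset [simp]:
  "valid n (add_mset (t, r) M) \<longleftrightarrow> 1 \<le> t \<and> 1 \<le> r \<and> r \<le> n \<and> valid n M"
  by (auto simp: valid_def)

lemma balance_add_mset [simp]:
  "balance i (add_mset (u, r) M) t = balance i M t
     + (if r = Suc i \<and> u \<le> t then 1 else 0) - (if r = i \<and> u < t then 1 else 0)"
  by (simp add: balance_def)

lemma row_size_add_mset [simp]:
  "row_size r (add_mset (u, s) M) = row_size r M + (if s = r then 1 else 0)"
  by (simp add: row_size_def)

lemma balance_Suc:
  "balance i M (Suc t) = balance i M t + int (count M (Suc t, Suc i)) - int (count M (t, i))"
proof (induction M)
  case empty
  then show ?case by (simp add: balance_def)
next
  case (add x M)
  then show ?case by (cases x) auto
qed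

lemma balance_0: "valid n M \<Longrightarrow> balance i M 0 = 0"
  by (induction M) (auto simp: balance_def valid_def)

lemma balance_eventually:
  "\<exists>K. \<forall>t\<ge>K. balance i M t = int (row_size (Suc i) M) - int (row_size i M)"
proof (induction M)
  case empty
  then show ?case by (simp add: balance_def row_size_def)
next
  case (add x M)
  then obtain K where "\<forall>t\<ge>K. balance i M t = int (row_size (Suc i) M) - int (row_size i M)"
    by blast
  then show ?case
    by (intro exI[of _ "max K (Suc (fst x))"]) (cases x; auto)
qed

lemma raises_unique: "raises i M s \<Longrightarrow> raises i M t \<Longrightarrow> s = t"
  unfolding raises_def by (metis linorder_neqE_nat not_less)

lemma lowers_unique: "lowers i M s \<Longrightarrow> lowers i M t \<Longrightarrow> s = t"
  unfolding lowers_def by (metis linorder_neqE_nat not_less)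

text \<open>A first argmax is a strict increase over the place before it, and by
  \<open>balance_Suc\<close> only a cell of that content in the lower row can cause one.\<close>

lemma raises_mem: 
  assumes "raises i M t" shows "(t, Suc i) \<in># M"
proof -
  obtain s where s: "t = Suc s" using assms by (cases t) (auto simp: raises_def)
  have "balance i M s < balance i M t" using assms s by (auto simp: raises_def)
  then have "0 < count M (t, Suc i)" unfolding s balance_Suc by linarith
  then show ?thesis by simp
qed

lemma lowers_mem: 
  assumes "lowers i M t" shows "(t, i) \<in># M"
proof -
  have "balance i M (Suc t) < balance i M t" using assms by (auto simp: lowers_def)
  then have "0 < count M (t, i)" unfolding balance_Suc by linarith
  then show ?thesis by simp
qed

text \<open>Both sides say that the balance of \<open>M\<close> is maximal at \<open>t\<close>: over
  the integers, the added cell turns the weak inequalities into strict ones on the appropriate side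
  of \<open>t\<close>. So raising and lowering are mutually inverse.\<close>

lemma raises_iff_lowers:
  assumes "0 < t"
  shows "raises i (add_mset (t, Suc i) M) t \<longleftrightarrow> lowers i (add_mset (t, i) M) t"
  unfolding raises_def lowers_def using assms by (auto split: if_splits)

lemma upI: "raises i M t \<Longrightarrow> up i M (M - {#(t, Suc i)#} + {#(t, i)#})"
  unfolding up_def using raises_mem by (metis add_mset_add_single insert_DiffM)

lemma up_iff_raises: "up i M K \<longleftrightarrow> (\<exists>t. raises i M t \<and> K = M - {#(t, Suc i)#} + {#(t, i)#})"
  unfolding up_def using raises_mem by (metis add_mset_add_single add_mset_remove_trivial insert_DiffM)

lemma up_iff_lowers:
  assumes "valid n K"
  shows "up i M K \<longleftrightarrow> (\<exists>t. lowers i K t \<and> M = K - {#(t, i)#} + {#(t, Suc i)#})"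
proof
  assume "up i M K"
  then obtain t M0 where "M = add_mset (t, Suc i) M0" "K = add_mset (t, i) M0" "raises i M t"
    by (auto simp: up_def)
  moreover from this have "lowers i K t" using raises_iff_lowers[of t i M0] by (simp add: raises_def)
  ultimately show "\<exists>t. lowers i K t \<and> M = K - {#(t, i)#} + {#(t, Suc i)#}"
    by (intro exI[of _ t]) auto
next
  assume "\<exists>t. lowers i K t \<and> M = K - {#(t, i)#} + {#(t, Suc i)#}"
  then obtain t where t: "lowers i K t" and M: "M = K - {#(t, i)#} + {#(t, Suc i)#}" by blast
  then have K: "K = add_mset (t, i) (K - {#(t, i)#})" using lowers_mem by simp
  then have "0 < t" using assms by (metis valid_add_mset not_one_le_zero gr0I)
  then show "up i M K"
    unfolding up_def using t K M raises_iff_lowers[of t i "K - {#(t, i)#}"] by auto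
qed

lemma up_functional: "up i M K \<Longrightarrow> up i M K' \<Longrightarrow> K = K'"
  unfolding up_iff_raises using raises_unique by blast

lemma up_injective: "valid n K \<Longrightarrow> up i M K \<Longrightarrow> up i M' K \<Longrightarrow> M = M'"
  by (metis up_iff_lowers lowers_unique)

section \<open>Existence of extremal argmaxes\<close>

lemma ex_up_iff:
  assumes "valid n M"
  shows "(\<exists>K. up i M K) \<longleftrightarrow> (\<exists>t. 0 < balance i M t)"
proof
  assume "\<exists>K. up i M K"
  then obtain t where "raises i M t" unfolding up_iff_raises by blast
  then have "balance i M 0 < balance i M t" by (auto simp: raises_def)
  then show "\<exists>t. 0 < balance i M t" using balance_0[OF assms] by auto
next
  assume "\<exists>t. 0 < balance i M t"
  then obtain t where t: "0 < balance i M t" by blast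
  obtain K where K: "\<And>t. K \<le> t \<Longrightarrow> balance i M t = int (row_size (Suc i) M) - int (row_size i M)"
    using balance_eventually by blast
  \<comment> \<open>All values beyond \<open>K\<close> equal the one at \<open>K\<close>, so this is
    the maximum over all places.\<close>
  define m where "m = Max (balance i M ` {..K})"
  have le: "balance i M s \<le> m" for s
  proof (cases "s \<le> K")
    case True then show ?thesis by (auto simp: m_def)
  next
    case False
    then have "balance i M s = balance i M K" using K[of s] K[of K] by simp
    then show ?thesis by (auto simp: m_def)
  qed
  have "m \<in> balance i M ` {..K}" unfolding m_def by (rule Max_in) auto
  then have ex: "\<exists>s. balance i M s = m" by auto
  define u where "u = (LEAST s. balance i M s = m)"
  have u: "balance i M u = m" unfolding u_def by (rule LeastI_ex[OF ex])
  have "balance i M s < m" if "s < u" for s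
    using not_less_Least that le[of s] unfolding u_def by (metis order_le_less)
  moreover have "u \<noteq> 0" using u le[of t] t balance_0[OF assms, of i] by (metis not_less)
  ultimately have "raises i M u" using le u by (auto simp: raises_def)
  then show "\<exists>K. up i M K" using upI by blast
qed

lemma ex_down_iff:
  assumes "valid n K"
  shows "(\<exists>M. up i M K) \<longleftrightarrow> (\<exists>t. int (row_size (Suc i) K) - int (row_size i K) < balance i K t)"
    (is "_ \<longleftrightarrow> (\<exists>t. ?c < _)")
proof -
  obtain k where k: "\<And>t. k \<le> t \<Longrightarrow> balance i K t = ?c"
    using balance_eventually by blast
  show ?thesis
  proof
    assume "\<exists>M. up i M K"
    then obtain t where "lowers i K t" using up_iff_lowers[OF assms] by blast
    then have "balance i K (max k (Suc t)) < balance i K t" by (auto simp: lowers_def)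
    then show "\<exists>t. ?c < balance i K t" using k by auto
  next
    assume "\<exists>t. ?c < balance i K t"
    then obtain t where t: "?c < balance i K t" by blast
    define m where "m = Max (balance i K ` {..k})"
    have tk: "t \<le> k" using t k[of t] by force
    have le: "balance i K s \<le> m" if "s \<le> k" for s using that by (auto simp: m_def)
    have cm: "?c < m" using le[OF tk] t by simp
    have mem: "m \<in> balance i K ` {..k}" unfolding m_def by (rule Max_in) auto
    define S where "S = {s. s \<le> k \<and> balance i K s = m}"
    have "finite S" "S \<noteq> {}" using mem by (auto simp: S_def)
    then have u: "Max S \<in> S" by (rule Max_in)
    have "balance i K s < m" if "Max S < s" for s
    proof (cases "s \<le> k")
      case True
      have "s \<notin> S" using that \<open>finite S\<close> by (metis Max_ge not_less)
      then show ?thesis using le[OF True] True by (auto simp: S_def)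
    next
      case False then show ?thesis using k[of s] cm by simp
    qed
    then have "lowers i K (Max S)" using u le by (auto simp: lowers_def S_def)
    then show "\<exists>M. up i M K" using up_iff_lowers[OF assms] by blast
  qed
qed

lemma up_valid: "up i M K \<Longrightarrow> valid n M \<Longrightarrow> 1 \<le> i \<Longrightarrow> valid n K"
  by (auto simp: up_def)

lemma up_valid_back: "up i M K \<Longrightarrow> valid n K \<Longrightarrow> i < n \<Longrightarrow> valid n M"
  by (auto simp: up_def)

lemma up_valid_swapped: "up i M K \<Longrightarrow> 1 \<le> i \<Longrightarrow> valid N (swapped M) \<longleftrightarrow> valid N (swapped K)"
  by (auto simp: up_def)

lemma up_swappedE:
  assumes "up j (swapped M) (swapped M')"
  obtains r M0 where "M = add_mset (Suc j, r) M0" "M' = add_mset (j, r) M0"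
    "raises j (swapped M) r"
proof -
  obtain t M0 where 1: "swapped M = add_mset (t, Suc j) M0" "swapped M' = add_mset (t, j) M0"
    and 2: "raises j (swapped M) t"
    using assms by (auto simp: up_def)
  have "M = add_mset (Suc j, t) (swapped M0)" "M' = add_mset (j, t) (swapped M0)"
    using arg_cong[OF 1(1), of swapped] arg_cong[OF 1(2), of swapped] by simp_all
  then show ?thesis using 2 that by blast
qed

lemma row_size_up_swapped: "up j (swapped M) (swapped M') \<Longrightarrow> row_size r M' = row_size r M"
  by (erule up_swappedE) simp

lemma up_swappedI:
  "raises j (swapped (add_mset (Suc j, r) M0)) r \<Longrightarrow>
     up j (swapped (add_mset (Suc j, r) M0)) (swapped (add_mset (j, r) M0))"
  by (auto simp: up_def)

section \<open>Commutation of row and column operators\<close>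

lemma balance_swapped:
  "balance i M (Suc j) - balance i M j =
     balance j (swapped M) (Suc i) - balance j (swapped M) i"
  by (simp add: balance_Suc)

text \<open>Partial sums feel a move between neighbouring contents at one place only; the place
  differs for the two rows because of \<open>\<le>\<close> against \<open><\<close>.\<close>

lemma balance_move:
  "balance i (add_mset (j, r) M) t = balance i (add_mset (Suc j, r) M) t
     + (if r = Suc i \<and> t = j then 1 else 0) - (if r = i \<and> t = Suc j then 1 else 0)"
  by auto

text \<open>Extremality of \<open>r\<close> for the column pair, tested at the neighbouring row and
  carried over by \<open>balance_swapped\<close>. It controls the two places that
  \<open>balance_move\<close> can change.\<close>

lemma raises_swapped_balance:
  assumes "raises j (swapped M) r"
  shows "r = Suc i \<Longrightarrow> balance i M j < balance i M (Suc j)"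
    and "r = i \<Longrightarrow> balance i M (Suc j) \<le> balance i M j"
proof -
  show "balance i M j < balance i M (Suc j)" if "r = Suc i"
  proof -
    have "balance j (swapped M) i < balance j (swapped M) (Suc i)"
      using assms that by (auto simp: raises_def)
    then show ?thesis using balance_swapped[of i M j] by linarith
  qed
  show "balance i M (Suc j) \<le> balance i M j" if "r = i"
  proof -
    have "balance j (swapped M) (Suc i) \<le> balance j (swapped M) i"
      using assms that by (auto simp: raises_def)
    then show ?thesis using balance_swapped[of i M j] by linarith
  qed
qed

text \<open>A value increased at \<open>j\<close> reaches at most the value at \<open>Suc j\<close>,
  and a value decreased at \<open>Suc j\<close> was at most the one at \<open>j\<close>; so the
  maximum stays. The threshold \<open>c\<close> will be 0 for raising and the eventual value for
  lowering.\<close>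

lemma up_swapped_balance_gt:
  assumes "up j (swapped M) (swapped M')"
  shows "(\<exists>t. c < balance i M t) \<longleftrightarrow> (\<exists>t. c < balance i M' t)"
proof -
  obtain r M0 where M: "M = add_mset (Suc j, r) M0" "M' = add_mset (j, r) M0"
    and r: "raises j (swapped M) r"
    using assms by (rule up_swappedE)
  have b: "balance i M' t = balance i M t
     + (if r = Suc i \<and> t = j then 1 else 0) - (if r = i \<and> t = Suc j then 1 else 0)" for t
    unfolding M by (rule balance_move)
  show ?thesis
  proof
    assume "\<exists>t. c < balance i M t"
    then obtain t where t: "c < balance i M t" by blast
    show "\<exists>t. c < balance i M' t"
    proof (cases "r = i \<and> t = Suc j")
      case True
      then have "c < balance i M' j" using raises_swapped_balance(2)[OF r] t b[of j] by auto
      then show ?thesis by blast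
    next
      case False
      then have "c < balance i M' t" using t b[of t] by auto
      then show ?thesis by blast
    qed
  next
    assume "\<exists>t. c < balance i M' t"
    then obtain t where t: "c < balance i M' t" by blast
    show "\<exists>t. c < balance i M t"
    proof (cases "r = Suc i \<and> t = j")
      case True
      then have "c < balance i M (Suc j)" using raises_swapped_balance(1)[OF r, of i] t b[of j] by auto
      then show ?thesis by blast
    next
      case False
      then have "c < balance i M t" using t b[of t] by (auto split: if_splits)
      then show ?thesis by blast
    qed
  qed
qed

lemma up_swapped_ex_up:
  assumes "up j (swapped M) (swapped M')" and "valid n M" and "1 \<le> j"
  shows "(\<exists>K. up i M K) \<longleftrightarrow> (\<exists>K. up i M' K)"
proof -
  have "valid n M'" using assms by (auto elim: up_swappedE)
  then show ?thesis using up_swapped_balance_gt[OF assms(1)] assms(2) by (simp add: ex_up_iff)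
qed

lemma up_swapped_ex_down:
  assumes "up j (swapped M) (swapped M')" and "valid n M" and "1 \<le> j"
  shows "(\<exists>K. up i K M) \<longleftrightarrow> (\<exists>K. up i K M')"
proof -
  have "valid n M'" using assms by (auto elim: up_swappedE)
  then show ?thesis using up_swapped_balance_gt[OF assms(1)] assms(2) row_size_up_swapped[OF assms(1)]
    by (simp add: ex_down_iff)
qed

text \<open>A column move in row \<open>r\<close> changes the content chosen by a row move only if both want to move
  the same cell, and that cell is the only surplus of \<open>(Suc j, Suc i)\<close> over \<open>(j, i)\<close>.\<close>

lemma raises_after_up_swapped:
  assumes M: "M = add_mset (Suc j, r) M0" and r: "raises j (swapped M) r" and t: "raises i M t"
    and j: "1 \<le> j"
  shows "raises i (add_mset (j, r) M0)
     (if (t, Suc i) = (Suc j, r) \<and> balance i M (Suc j) = balance i M j + 1 then j else t)"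
proof -
  let ?M' = "add_mset (j, r) M0"
  have b: "balance i ?M' s = balance i M s
     + (if r = Suc i \<and> s = j then 1 else 0) - (if r = i \<and> s = Suc j then 1 else 0)" for s
    unfolding M by (rule balance_move)
  have lt: "s < t \<Longrightarrow> balance i M s < balance i M t"
    and gt: "t < s \<Longrightarrow> balance i M s \<le> balance i M t" and t0: "0 < t" for s
    using t by (auto simp: raises_def)
  have r1: "r = Suc i \<Longrightarrow> balance i M j < balance i M (Suc j)"
    and r2: "r = i \<Longrightarrow> balance i M (Suc j) \<le> balance i M j"
    using raises_swapped_balance[OF r] by auto
  show ?thesis
  proof (cases "r = Suc i")
    case True
    have b': "balance i ?M' s = balance i M s + (if s = j then 1 else 0)" for s
      using b[of s] True by simp
    show ?thesis
    proof (cases "t = Suc j \<and> balance i M (Suc j) = balance i M j + 1")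
      case C: True
      \<comment> \<open>The increase at \<open>j\<close> makes a tie with the old maximum at
        \<open>Suc j\<close>, and the first argmax is now \<open>j\<close>.\<close>
      have "balance i M s < balance i M j + 1" if "s < j" for s
        using lt[of s] C that by auto
      moreover have "balance i M s \<le> balance i M j + 1" if "j < s" for s
        using gt[of s] C that by (cases "s = Suc j") auto
      ultimately show ?thesis using C True j unfolding raises_def b' by auto
    next
      case C: False
      have tj: "t \<noteq> j" using gt[of "Suc j"] r1[OF True] by auto
      have j1: "balance i M j + 1 < balance i M t" if "j < t"
        using lt[of "Suc j"] r1[OF True] C that by (cases "t = Suc j") auto
      have j2: "balance i M j + 1 \<le> balance i M t" if "t < j"
        using gt[of "Suc j"] r1[OF True] that by auto
      have "raises i ?M' t" using lt gt t0 tj j1 j2 unfolding raises_def b' by auto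
      then show ?thesis using C True by (auto split: if_splits)
    qed
  next
    case False
    \<comment> \<open>The balance does not grow from \<open>j\<close> to \<open>Suc j\<close>, which
      excludes \<open>Suc j\<close> as a first argmax; so the decreased value is not the one at
      \<open>t\<close>.\<close>
    have tj: "\<not> (r = i \<and> t = Suc j)" using lt[of j] r2 by auto
    have b': "balance i ?M' s = balance i M s - (if r = i \<and> s = Suc j then 1 else 0)" for s
      using b[of s] False by simp
    have "balance i ?M' t = balance i M t" "balance i ?M' s \<le> balance i M s" for s
      using tj unfolding b' by auto
    then have "raises i ?M' t" using lt gt t0 unfolding raises_def by (metis order.trans order.strict_trans1)
    then show ?thesis using False by auto
  qed
qed

text \<open>The exceptional case \<open>?C\<close> is invariant under transposition by
  \<open>balance_swapped\<close>. In it the cell \<open>(Suc j, Suc i)\<close> goes to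
  \<open>(j, i)\<close> in either order; otherwise the two moves concern different cells.\<close>

lemma up_swapped_commute:
  assumes c: "up j (swapped M) (swapped M')" and e: "up i M K" and i: "1 \<le> i" and j: "1 \<le> j"
  shows "\<exists>K'. up i M' K' \<and> up j (swapped K) (swapped K')"
proof -
  obtain r M0 where M: "M = add_mset (Suc j, r) M0" "M' = add_mset (j, r) M0"
    and r: "raises j (swapped M) r"
    using c by (rule up_swappedE)
  obtain t M1 where K: "M = add_mset (t, Suc i) M1" "K = add_mset (t, i) M1"
    and t: "raises i M t"
    using e by (auto simp: up_def)
  let ?C = "t = Suc j \<and> r = Suc i \<and> balance i M (Suc j) = balance i M j + 1"
  have M'r: "raises i M' (if ?C then j else t)"
    using raises_after_up_swapped[OF M(1) r t j] unfolding M(2) by (auto split: if_splits)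
  have Kr: "raises j (swapped K) (if ?C then i else r)"
  proof -
    have tK: "swapped M = add_mset (Suc i, t) (swapped M1)" using K by simp
    have "(r, Suc j) = (Suc i, t) \<and> balance j (swapped M) (Suc i) = balance j (swapped M) i + 1 \<longleftrightarrow> ?C"
      using balance_swapped[of i M j] by auto
    moreover have "raises j (swapped K) (if (r, Suc j) = (Suc i, t) \<and>
        balance j (swapped M) (Suc i) = balance j (swapped M) i + 1 then i else r)"
      using raises_after_up_swapped[OF tK _ r i] t unfolding K(2) by simp
    ultimately show ?thesis by presburger
  qed
  show ?thesis
  proof (cases ?C)
    case True
    then have "M0 = M1" using M K by auto
    have "up i M' (add_mset (j, i) M0)" using M'r M True by (auto simp: up_def)
    moreover have "up j (swapped K) (swapped (add_mset (j, i) M0))"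
      using Kr K True \<open>M0 = M1\<close> up_swappedI by auto
    ultimately show ?thesis by blast
  next
    case False
    then have M't: "raises i M' t" and Kr: "raises j (swapped K) r" using M'r Kr by auto
    \<comment> \<open>The row operator still picks \<open>t\<close> after the column move. Even if
      both moves start at the same pair, a second copy of it must therefore be present.\<close>
    have "(t, Suc i) \<in># M0"
    proof (cases "(t, Suc i) = (Suc j, r)")
      case True
      then show ?thesis using raises_mem[OF M't] M(2) by auto
    next
      case False
      then show ?thesis using K(1) M(1) by (metis insert_noteq_member union_single_eq_member)
    qed
    then obtain L where L: "M0 = add_mset (t, Suc i) L" by (metis multi_member_split)
    then have M1: "M1 = add_mset (Suc j, r) L" using M K by (auto simp: add_mset_commute)
    have "up i M' (add_mset (j, r) (add_mset (t, i) L))"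
      using M't unfolding up_def
      by (intro exI[of _ t] exI[of _ "add_mset (j, r) L"]) (simp add: M(2) L add_mset_commute)
    moreover have "up j (swapped K) (swapped (add_mset (j, r) (add_mset (t, i) L)))"
      using Kr up_swappedI[of j r "add_mset (t, i) L"] unfolding K(2) M1
      by (simp only: add_mset_commute[of "(j, r)"] add_mset_commute[of "(Suc j, r)"])
    ultimately show ?thesis by blast
  qed
qed

text \<open>The column operator is defined at \<open>K\<close> because a row step does not affect
  its existence; the commuting square over \<open>K\<close> then ends at \<open>M'\<close> by
  functionality of \<open>up\<close>.\<close>

lemma up_swapped_commute_down:
  assumes c: "up j (swapped M) (swapped M')" and e: "up i K M" and i: "1 \<le> i" and j: "1 \<le> j"
    and M: "valid n M" "valid N (swapped M)" and "i < n"
  shows "\<exists>K'. up i K' M' \<and> up j (swapped K) (swapped K')"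
proof -
  have "valid n K" "valid N (swapped K)"
    using up_valid_back[OF e M(1)] up_valid_swapped[OF e i] M \<open>i < n\<close> by auto
  then have "\<exists>K'. up j (swapped K) K'"
    using up_swapped_ex_up[of i "swapped K" "swapped M" N j] e c i by auto
  then obtain K' where K': "up j (swapped K) (swapped K')" by (metis swapped_swapped)
  obtain M'' where "up i K' M''" "up j (swapped M) (swapped M'')"
    using up_swapped_commute[OF K' e i j] by blast
  then show ?thesis
    using up_functional[OF c, of "swapped M''"] K' by (metis swapped_swapped)
qed

section \<open>Fillings and ptableaux\<close>

lemma filling_bounds:
  "filling n A \<Longrightarrow> box A r c = Some j \<Longrightarrow> 1 \<le> r \<and> r \<le> n \<and> 1 \<le> c \<and> c \<le> ncols A \<and> 1 \<le> j"
  by (auto simp: filling_def)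

text \<open>Both conditions on a filling say together that the column is a strictly increasing
  function on the cells, for the order in which contents grow and rows go up.\<close>

lemma filling_iff:
  "filling n A \<longleftrightarrow>
     (\<forall>r c j. box A r c = Some j \<longrightarrow> 1 \<le> r \<and> r \<le> n \<and> 1 \<le> c \<and> c \<le> ncols A \<and> 1 \<le> j) \<and>
     (\<forall>i j r c r' c'. box A r c = Some i \<longrightarrow> box A r' c' = Some j \<longrightarrow> i \<le> j \<longrightarrow> r' \<le> r \<longrightarrow>
        (i, r) \<noteq> (j, r') \<longrightarrow> c < c')"
    (is "_ \<longleftrightarrow> ?B \<and> ?O")
proof
  assume A: "filling n A"
  have "c < c'" if "box A r c = Some i" "box A r' c' = Some j" "i \<le> j" "r' \<le> r" "(i, r) \<noteq> (j, r')"
    for i j r c r' c'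
  proof (cases "i = j")
    case True
    then have "r' < r" using that by auto
    then show ?thesis using A that True by (auto simp: filling_def horizontal_strip_def)
  next
    case False
    then have "\<not> (r' \<le> r \<and> c' \<le> c)" using A that unfolding filling_def by (metis order_le_less)
    then show ?thesis using that by auto
  qed
  moreover have ?B using A unfolding filling_def by blast
  ultimately show "?B \<and> ?O" by blast
next
  assume B: "?B \<and> ?O"
  then have O: "box A r c = Some i \<Longrightarrow> box A r' c' = Some j \<Longrightarrow> i \<le> j \<Longrightarrow> r' \<le> r \<Longrightarrow>
     (i, r) \<noteq> (j, r') \<Longrightarrow> c < c'" for i j r c r' c' by blast
  have "horizontal_strip {(r, c). box A r c = Some i}" for i
    using O[of _ _ i _ _ i] by (auto simp: horizontal_strip_def)
  moreover have "\<not> (r' \<le> r \<and> c' \<le> c)"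
    if "i < j" "box A r c = Some i" "box A r' c' = Some j" for i j r c r' c'
    using O[OF that(2,3)] that(1) by auto
  ultimately show "filling n A" unfolding filling_def using B by blast
qed

lemma filling_less:
  "filling n A \<Longrightarrow> box A r c = Some i \<Longrightarrow> box A r' c' = Some j \<Longrightarrow> i \<le> j \<Longrightarrow> r' \<le> r \<Longrightarrow>
     (i, r) \<noteq> (j, r') \<Longrightarrow> c < c'"
  unfolding filling_iff by blast

lemma filling_row_mono:
  assumes "filling n A" "box A r c = Some i" "box A r d = Some j" "c \<le> d"
  shows "i \<le> j"
  using filling_less[OF assms(1,3,2)] assms(4) by force

lemma filling_finite: "filling n A \<Longrightarrow> finite {(r, c). box A r c \<noteq> None}"
  by (rule finite_subset[of _ "{1..n} \<times> {1..ncols A}"]) (auto dest: filling_bounds)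

lemma filling_finite_row: "filling n A \<Longrightarrow> finite {c. \<exists>u. box A r c = Some u \<and> P u}"
  by (rule finite_subset[of _ "{1..ncols A}"]) (auto dest: filling_bounds)

section \<open>Counting cells by columns\<close>

lemma size_filter_array_cells:
  assumes "filling n A"
  shows "size {#p \<in># array_cells A. snd p = r \<and> P (fst p)#} = card {c. \<exists>u. box A r c = Some u \<and> P u}"
proof -
  let ?S = "{(r, c). box A r c \<noteq> None}"
  have fin: "finite ?S" using filling_finite[OF assms] .
  have "size {#p \<in># array_cells A. snd p = r \<and> P (fst p)#} =
      size {#x \<in># mset_set ?S. fst x = r \<and> P (the (box A r (snd x)))#}"
    unfolding array_cells_def filter_mset_image_mset size_image_mset
    by (rule arg_cong[where f = size], rule filter_mset_cong) (auto simp: case_prod_unfold)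
  also have "\<dots> = card {x \<in> ?S. fst x = r \<and> P (the (box A r (snd x)))}"
    using fin by simp
  also have "{x \<in> ?S. fst x = r \<and> P (the (box A r (snd x)))}
      = Pair r ` {c. \<exists>u. box A r c = Some u \<and> P u}"
    by auto
  also have "card \<dots> = card {c. \<exists>u. box A r c = Some u \<and> P u}"
    by (rule card_image) (auto simp: inj_on_def)
  finally show ?thesis .
qed

lemma count_eq_size: "count M x = size {#y \<in># M. y = x#}"
  by (induction M) auto

lemma count_array_cells:
  assumes "filling n A"
  shows "count (array_cells A) (u, r) = card {c. box A r c = Some u}"
proof -
  have "count (array_cells A) (u, r) = size {#p \<in># array_cells A. p = (u, r)#}"
    by (rule count_eq_size)
  also have "{#p \<in># array_cells A. p = (u, r)#} = {#p \<in># array_cells A. snd p = r \<and> fst p = u#}"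
    by (rule filter_mset_cong) auto
  finally show ?thesis using size_filter_array_cells[OF assms, of r "\<lambda>x. x = u"] by simp
qed

lemma array_cells_eqI:
  assumes "filling n A" "\<And>u r. count M (u, r) = card {c. box A r c = Some u}"
  shows "array_cells A = M"
  using count_array_cells[OF assms(1)] assms(2) by (intro multiset_eqI) auto

lemma array_cells_valid:
  assumes "filling n A" shows "valid n (array_cells A)"
  using filling_finite[OF assms] filling_bounds[OF assms]
  by (auto simp: valid_def array_cells_def) 

section \<open>Swaps of a blank with a cell\<close>

lemma box_shift_cell:
  "box (shift_cell A r c c') s d =
     (if s = r \<and> d = c' then box A r c else if s = r \<and> d = c then None else box A s d)"
  by (auto simp: shift_cell_def)

lemma ncols_shift_cell [simp]: "ncols (shift_cell A r c c') = ncols A"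
  by (simp add: shift_cell_def)

lemma array_cells_shift_cell:
  assumes "filling n A" "filling m (shift_cell A r c c')" "box A r c \<noteq> None" "box A r c' = None"
  shows "array_cells (shift_cell A r c c') = array_cells A"
proof (rule array_cells_eqI[OF assms(2)])
  fix u s
  \<comment> \<open>In row \<open>r\<close> the columns \<open>c\<close> and \<open>c'\<close> trade
    places; the map is its own inverse.\<close>
  let ?f = "\<lambda>d. if s = r then if d = c then c' else if d = c' then c else d else d"
  have "bij_betw ?f {d. box A s d = Some u} {d. box (shift_cell A r c c') s d = Some u}"
    using assms(3,4)
    by (intro bij_betw_byWitness[where f' = ?f])
      (auto simp: box_shift_cell split: if_splits)
  then show "count (array_cells A) (u, s) = card {d. box (shift_cell A r c c') s d = Some u}"
    unfolding count_array_cells[OF assms(1)] by (rule bij_betw_same_card)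
qed

lemma swap_step_invariants:
  assumes "(swap_step n)\<^sup>*\<^sup>* A B" and "filling n A"
  shows "filling n B \<and> array_cells B = array_cells A \<and> ncols B = ncols A"
  using assms
proof (induction rule: rtranclp_induct)
  case base
  then show ?case by simp
next
  case (step B C)
  then show ?case using array_cells_shift_cell[of n B n] by (auto simp: swap_step_def)
qed

lemma swap_step_sym: "swap_step n A B \<Longrightarrow> swap_step n B A"
proof -
  assume "swap_step n A B"
  then obtain r c c' where f: "filling n A" "filling n B" and c: "c' = Suc c \<or> c = Suc c'"
    and b: "box A r c \<noteq> None" "box A r c' = None" and B: "B = shift_cell A r c c'"
    by (auto simp: swap_step_def)
  have "A = shift_cell B r c' c"
    unfolding B using b c by (cases A) (auto simp: shift_cell_def fun_eq_iff)
  moreover have "box B r c' \<noteq> None" "box B r c = None" using b c by (auto simp: B box_shift_cell)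
  ultimately show ?thesis using f c unfolding swap_step_def by blast
qed

lemma swap_steps_sym: "(swap_step n)\<^sup>*\<^sup>* A B \<Longrightarrow> (swap_step n)\<^sup>*\<^sup>* B A"
  by (metis swap_step_sym sympI symp_rtranclp sympD)

text \<open>Moving left endangers only the constraints from cells that must lie further left. These
  were in columns at most \<open>c\<close> before, so only those in column \<open>c\<close> itself
  matter, and they lie below row \<open>r\<close> with content at most \<open>j\<close>.\<close>

lemma filling_shift_left:
  assumes A: "filling n A" and b: "box A r (Suc c) = Some j" "box A r c = None" and "1 \<le> c"
    and free: "\<And>s i. r < s \<Longrightarrow> box A s c = Some i \<Longrightarrow> j < i"
  shows "filling n (shift_cell A r (Suc c) c)"
proof -
  let ?B = "shift_cell A r (Suc c) c"
  have "x < y" if xy: "box ?B s x = Some i" "box ?B s' y = Some k" "i \<le> k" "s' \<le> s" "(i, s) \<noteq> (k, s')"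
    for s x i s' y k
  proof (cases "s = r \<and> x = c")
    case True
    have "\<not> (s' = r \<and> y = c)" using True xy by auto
    moreover have "i = j" using True xy b by (simp add: box_shift_cell)
    ultimately show ?thesis
      using filling_less[OF A b(1), of s' y k] xy True by (auto simp: box_shift_cell split: if_splits)
  next
    case s: False
    then have x: "box A s x = Some i" using xy by (auto simp: box_shift_cell split: if_splits)
    show ?thesis
    proof (cases "s' = r \<and> y = c")
      case True
      then have "k = j" using xy b by (simp add: box_shift_cell)
      then have "x < Suc c" using filling_less[OF A x b(1)] True xy by simp
      moreover have "x \<noteq> c" using x free[of s i] b True xy \<open>k = j\<close> by (cases "s = r") auto
      ultimately show ?thesis using True by simp
    next
      case False
      then have "box A s' y = Some k" using xy by (auto simp: box_shift_cell split: if_splits)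
      then show ?thesis using filling_less[OF A x] xy by blast
    qed
  qed
  moreover have "1 \<le> s \<and> s \<le> n \<and> 1 \<le> x \<and> x \<le> ncols ?B \<and> 1 \<le> i" if "box ?B s x = Some i" for s x i
    using that filling_bounds[OF A, of s x i] filling_bounds[OF A b(1)] b \<open>1 \<le> c\<close>
    by (auto simp: box_shift_cell split: if_splits)
  ultimately show ?thesis unfolding filling_iff by blast
qed

lemma filling_shift_right:
  assumes A: "filling n A" and b: "box A r c = Some j" "box A r (Suc c) = None" and "Suc c \<le> ncols A"
    and free: "\<And>s i. s < r \<Longrightarrow> box A s (Suc c) = Some i \<Longrightarrow> i < j"
  shows "filling n (shift_cell A r c (Suc c))"
proof -
  let ?B = "shift_cell A r c (Suc c)"
  have "x < y" if xy: "box ?B s x = Some i" "box ?B s' y = Some k" "i \<le> k" "s' \<le> s" "(i, s) \<noteq> (k, s')"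
    for s x i s' y k
  proof (cases "s' = r \<and> y = Suc c")
    case True
    have "\<not> (s = r \<and> x = Suc c)" using True xy by auto
    moreover have "k = j" using True xy b by (simp add: box_shift_cell)
    ultimately show ?thesis
      using filling_less[OF A _ b(1), of s x i] xy True by (auto simp: box_shift_cell split: if_splits)
  next
    case s: False
    then have y: "box A s' y = Some k" using xy by (auto simp: box_shift_cell split: if_splits)
    show ?thesis
    proof (cases "s = r \<and> x = Suc c")
      case True
      then have "i = j" using xy b by (simp add: box_shift_cell)
      then have "c < y" using filling_less[OF A b(1) y] True xy by simp
      moreover have "y \<noteq> Suc c" using y free[of s' k] b True xy \<open>i = j\<close> by (cases "s' = r") auto
      ultimately show ?thesis using True by simp
    next
      case False
      then have "box A s x = Some i" using xy by (auto simp: box_shift_cell split: if_splits)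
      then show ?thesis using filling_less[OF A _ y] xy by blast
    qed
  qed
  moreover have "1 \<le> s \<and> s \<le> n \<and> 1 \<le> x \<and> x \<le> ncols ?B \<and> 1 \<le> i" if "box ?B s x = Some i" for s x i
    using that filling_bounds[OF A, of s x i] filling_bounds[OF A b(1)] b \<open>Suc c \<le> ncols A\<close>
    by (auto simp: box_shift_cell split: if_splits)
  ultimately show ?thesis unfolding filling_iff by blast
qed

section \<open>Justified forms as normal forms\<close>

text \<open>The potential that makes justification terminate; \<open>w\<close> is the column number
  for the left form and the distance to the right border for the right form.\<close>

definition column_sum :: "(nat \<Rightarrow> nat) \<Rightarrow> parray \<Rightarrow> nat" where
  "column_sum w A = (\<Sum>(r, c) | box A r c \<noteq> None. w c)"

lemma column_sum_shift_cell:
  assumes A: "filling n A" and b: "box A r c \<noteq> None" "box A r c' = None"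
  shows "column_sum w (shift_cell A r c c') + w c = column_sum w A + w c'"
proof -
  let ?S = "{(r, c). box A r c \<noteq> None} - {(r, c)}"
  have fin: "finite ?S" using filling_finite[OF A] by simp
  have "{(s, d). box (shift_cell A r c c') s d \<noteq> None} = insert (r, c') ?S"
    using b by (auto simp: box_shift_cell split: if_splits)
  moreover have "(r, c') \<notin> ?S" using b by auto
  ultimately have 1: "column_sum w (shift_cell A r c c') = w c' + (\<Sum>(r, c)\<in>?S. w c)"
    using fin by (simp add: column_sum_def)
  have "{(r, c). box A r c \<noteq> None} = insert (r, c) ?S" using b by auto
  then have "column_sum w A = w c + (\<Sum>(r, c)\<in>?S. w c)"
    unfolding column_sum_def using fin by (metis (no_types, lifting) Diff_iff case_prod_conv insertI1 sum.insert)
  then show ?thesis using 1 by simp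
qed

lemma left_justified_exists:
  assumes "filling n A" shows "\<exists>L. left_justified_form n A L"
  using assms
proof (induction "column_sum id A" arbitrary: A rule: less_induct)
  case less
  show ?case
  proof (cases "left_justified_form n A A")
    case False
    then obtain r c where b: "box A r (Suc c) \<noteq> None" "box A r c = None"
      and f: "filling n (shift_cell A r (Suc c) c)" (is "filling n ?B")
      by (auto simp: left_justified_form_def)
    have "column_sum id ?B < column_sum id A"
      using column_sum_shift_cell[OF less.prems b, of id] by simp
    from less.hyps[OF this f] obtain L where L: "left_justified_form n ?B L" by blast
    have "swap_step n A ?B" using less.prems f b by (auto simp: swap_step_def)
    then have "left_justified_form n A L" using L
      by (auto simp: left_justified_form_def intro: converse_rtranclp_into_rtranclp)
    then show ?thesis by blast
  qed auto
qed

lemma right_justified_exists: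
  assumes "filling n A" shows "\<exists>R. right_justified_form n A R"
  using assms
proof (induction "column_sum (\<lambda>c. ncols A - c) A" arbitrary: A rule: less_induct)
  case less
  show ?case
  proof (cases "right_justified_form n A A")
    case False
    then obtain r c where b: "box A r c \<noteq> None" "box A r (Suc c) = None"
      and f: "filling n (shift_cell A r c (Suc c))" (is "filling n ?B")
      by (auto simp: right_justified_form_def)
    have "box ?B r (Suc c) \<noteq> None" using b by (simp add: box_shift_cell)
    then have "Suc c \<le> ncols A" using filling_bounds[OF f] by auto
    then have "column_sum (\<lambda>c. ncols ?B - c) ?B < column_sum (\<lambda>c. ncols A - c) A"
      using column_sum_shift_cell[OF less.prems b, of "\<lambda>c. ncols A - c"] by simp
    from less.hyps[OF this f] obtain R where R: "right_justified_form n ?B R" by blast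
    have "swap_step n A ?B" using less.prems f b by (auto simp: swap_step_def)
    then have "right_justified_form n A R" using R
      by (auto simp: right_justified_form_def intro: converse_rtranclp_into_rtranclp)
    then show ?thesis by blast
  qed auto
qed

text \<open>The cell found is either the left neighbour in the row or the obstruction that keeps the
  cell from moving left.\<close>

lemma left_justified_predecessor:
  assumes L: "filling n L" "left_justified_form n A L" and b: "box L r (Suc c) = Some j" and "1 \<le> c"
  shows "\<exists>s\<ge>r. \<exists>i\<le>j. box L s c = Some i"
proof (cases "box L r c")
  case None
  then have "\<not> filling n (shift_cell L r (Suc c) c)" using L b by (auto simp: left_justified_form_def)
  then obtain s i where "r < s" "box L s c = Some i" "\<not> j < i"
    using filling_shift_left[OF L(1) b None \<open>1 \<le> c\<close>] by blast
  then show ?thesis by (meson less_imp_le not_less)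
next
  case (Some i)
  then show ?thesis using filling_row_mono[OF L(1) Some b] by auto
qed

lemma left_justified_predecessors:
  assumes L: "filling n L" "left_justified_form n A L" and b: "box L r d = Some j" and "1 \<le> c" "c \<le> d"
  shows "\<exists>s\<ge>r. \<exists>i\<le>j. box L s c = Some i"
  using \<open>c \<le> d\<close> b
proof (induction d arbitrary: r j rule: dec_induct)
  case base
  then show ?case by blast
next
  case (step d)
  then show ?case using left_justified_predecessor[OF L step.prems] \<open>1 \<le> c\<close>
    by (meson le_trans)
qed

text \<open>The content \<open>j\<close> must occur in row \<open>r\<close> of \<open>L'\<close> at
  column \<open>c\<close> or later. A blank at \<open>(r, c)\<close> in \<open>L'\<close> would then
  force a cell below it of content at most \<open>j\<close>; by \<open>below\<close> it is also in
  \<open>L\<close>, where it conflicts with \<open>j\<close>. If the box is not blank, both arrays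
  hold there the least content that remains for the row.\<close>

lemma left_justified_box_eq:
  assumes L: "filling n L" "left_justified_form n A L" and L': "filling n L'" "left_justified_form n A' L'"
    and eq: "array_cells L = array_cells L'"
    and before: "\<And>d r. d < c \<Longrightarrow> box L r d = box L' r d"
    and below: "\<And>s. r < s \<Longrightarrow> box L s c = box L' s c"
    and j: "box L r c = Some j"
  shows "box L' r c = Some j"
proof -
  \<comment> \<open>Row \<open>r\<close> has equally many cells of content \<open>u\<close> in both
    arrays, and they agree in the columns before \<open>c\<close>.\<close>
  have rest: "\<exists>d\<ge>c. box L1 r d = Some u"
    if L1: "filling n L1" and L2: "filling n L2" and eq: "array_cells L1 = array_cells L2"
      and bef: "\<And>d. d < c \<Longrightarrow> box L1 r d = box L2 r d" and e: "c \<le> e" "box L2 r e = Some u"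
    for L1 L2 u e
  proof (rule ccontr)
    assume no: "\<not> ?thesis"
    have fin: "finite {d. box L2 r d = Some u}"
      using filling_finite_row[OF L2, of r "\<lambda>x. x = u"] by simp
    have "{d. box L1 r d = Some u} \<subseteq> {d. box L2 r d = Some u} - {e}"
    proof
      fix d assume d: "d \<in> {d. box L1 r d = Some u}"
      then have "d < c" using no not_le by blast
      then show "d \<in> {d. box L2 r d = Some u} - {e}" using d bef e by auto
    qed
    then have "card {d. box L1 r d = Some u} \<le> card ({d. box L2 r d = Some u} - {e})"
      using fin by (intro card_mono) auto
    also have "\<dots> < card {d. box L2 r d = Some u}" using fin e by (intro psubset_card_mono) auto
    finally show False
      using count_array_cells[OF L1, of u r] count_array_cells[OF L2, of u r] eq by simp
  qed
  obtain d where d: "c \<le> d" "box L' r d = Some j"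
    using rest[OF L'(1) L(1) eq[symmetric] before[symmetric] order_refl j] by blast
  have c: "1 \<le> c" using filling_bounds[OF L(1) j] by simp
  show ?thesis
  proof (cases "box L' r c")
    case None
    obtain s i where s: "s \<ge> r" "i \<le> j" "box L' s c = Some i"
      using left_justified_predecessors[OF L' d(2) c d(1)] by blast
    then have "r < s" using None by (cases "s = r") auto
    then have "c < c" using filling_less[OF L(1) _ j, of s c i] below[of s] s by auto
    then show ?thesis by simp
  next
    case (Some i)
    obtain e where e: "c \<le> e" "box L r e = Some i"
      using rest[OF L(1) L'(1) eq before order_refl Some] by blast
    have "i \<le> j" using filling_row_mono[OF L'(1) Some d(2,1)] .
    moreover have "j \<le> i" using filling_row_mono[OF L(1) j e(2,1)] .
    ultimately show ?thesis using Some by simp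
  qed
qed

lemma left_justified_unique:
  assumes L: "filling n L" "left_justified_form n A L" and L': "filling n L'" "left_justified_form n A' L'"
    and eq: "array_cells L = array_cells L'" and "ncols L = ncols L'"
  shows "L = L'"
proof -
  have "box L r c = box L' r c" for r c
  proof (induction c arbitrary: r rule: less_induct)
    case c: (less c)
    show ?case
    \<comment> \<open>Within a column the comparison runs from the bottom up. With
      \<open>n - r\<close> the row below row \<open>n\<close> would not have a smaller
      measure.\<close>
    proof (induction "Suc n - r" arbitrary: r rule: less_induct)
      case (less r)
      show ?case
      proof (cases "r \<le> n")
        case True
        then have "box L s c = box L' s c" if "r < s" for s using less that by auto
        then have "box L r c = Some j \<longleftrightarrow> box L' r c = Some j" for j
          using left_justified_box_eq[OF L L' eq c.IH, of c r j]
            left_justified_box_eq[OF L' L eq[symmetric] c.IH[symmetric], of c r j] by auto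
        then show ?thesis by (metis not_Some_eq)
      next
        case False
        then show ?thesis using filling_bounds[OF L(1), of r c] filling_bounds[OF L'(1), of r c]
          by (metis not_Some_eq)
      qed
    qed
  qed
  then show ?thesis using assms(6) by (intro parray.expand) (simp add: fun_eq_iff)
qed

text \<open>The left-justified form is a normal form determined by cells and width, and swaps are
  reversible.\<close>

lemma fillings_swap_connected:
  assumes A: "filling n A" and B: "filling n B" and eq: "array_cells A = array_cells B" "ncols A = ncols B"
  shows "(swap_step n)\<^sup>*\<^sup>* A B"
proof -
  obtain L L' where L: "left_justified_form n A L" and L': "left_justified_form n B L'"
    using left_justified_exists A B by blast
  have s: "(swap_step n)\<^sup>*\<^sup>* A L" "(swap_step n)\<^sup>*\<^sup>* B L'"
    using L L' by (auto simp: left_justified_form_def)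
  have "L = L'"
    using left_justified_unique[OF _ L _ L'] swap_step_invariants[OF s(1) A]
      swap_step_invariants[OF s(2) B] eq by auto
  then show ?thesis using s swap_steps_sym by (metis rtranclp_trans)
qed

text \<open>Each cell gets a column of its own, in an order that extends the one of \<open>filling_iff\<close>.\<close>

lemma filling_exists:
  assumes "valid n M" shows "\<exists>A. filling n A \<and> array_cells A = M"
proof -
  \<comment> \<open>Lexicographic order, first by content and then from the lowest row upwards; the
    factor works because \<open>n - r\<close> is less than \<open>Suc n\<close>.\<close>
  define key where "key = (\<lambda>(t, r). t * Suc n + (n - r))"
  obtain xs0 where "mset xs0 = M" using ex_mset by blast
  define xs where "xs = sort_key key xs0"
  have xs: "mset xs = M" "sorted (map key xs)" by (simp_all add: xs_def \<open>mset xs0 = M\<close>)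
  define A where "A = PArray (length xs) (\<lambda>r c. if 1 \<le> c \<and> c \<le> length xs \<and> snd (xs ! (c - 1)) = r
     then Some (fst (xs ! (c - 1))) else None)"
  have bA: "box A r c = Some j \<longleftrightarrow> 1 \<le> c \<and> c \<le> length xs \<and> xs ! (c - 1) = (j, r)" for r c j
    by (cases "xs ! (c - 1)") (auto simp: A_def)
  have range: "1 \<le> j \<and> 1 \<le> r \<and> r \<le> n" if "box A r c = Some j" for r c j
  proof -
    have "(j, r) \<in> set xs" using that unfolding bA by (metis One_nat_def Suc_le_eq Suc_pred nth_mem)
    then show ?thesis using assms xs(1) by (auto simp: valid_def)
  qed
  have "c < d" if cd: "box A r c = Some i" "box A s d = Some j" "i \<le> j" "s \<le> r" "(i, r) \<noteq> (j, s)"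
    for r c i s d j
  proof (rule ccontr)
    assume "\<not> c < d"
    then have "key (xs ! (d - 1)) \<le> key (xs ! (c - 1))"
      using sorted_nth_mono[OF xs(2), of "d - 1" "c - 1"] cd unfolding bA by auto
    then have key: "j * Suc n + (n - s) \<le> i * Suc n + (n - r)" using cd unfolding bA key_def by simp
    show False
    proof (cases "i = j")
      case True
      then show False using key cd range[OF cd(1)] by auto
    next
      case False
      then have "Suc i * Suc n \<le> j * Suc n" using cd by (intro mult_le_mono1) simp
      then show False using key range[OF cd(1)] by simp
    qed
  qed
  moreover have "1 \<le> c \<and> c \<le> ncols A" if "box A r c = Some j" for r c j
    using that unfolding bA by (simp add: A_def)
  ultimately have A: "filling n A"
    unfolding filling_iff using range by blast
  have "array_cells A = M"
  proof (rule array_cells_eqI[OF A])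
    fix u r
    have "count M (u, r) = length (filter (\<lambda>x. x = (u, r)) xs)"
      unfolding xs(1)[symmetric] count_eq_size mset_filter[symmetric] size_mset ..
    also have "\<dots> = card {k. k < length xs \<and> xs ! k = (u, r)}" by (rule length_filter_conv_card)
    also have "\<dots> = card (Suc ` {k. k < length xs \<and> xs ! k = (u, r)})"
      by (rule card_image[symmetric]) auto
    also have "Suc ` {k. k < length xs \<and> xs ! k = (u, r)} = {c. box A r c = Some u}"
      unfolding bA by (auto simp: image_iff) (metis Suc_pred' Suc_le_eq One_nat_def diff_Suc_1)
    finally show "count M (u, r) = card {c. box A r c = Some u}" .
  qed
  then show ?thesis using A by blast
qed

section \<open>Ptableaux as multisets\<close>

lemma ptableau_array_exists:
  assumes "valid n M" shows "\<exists>A. ptableau_array n A \<and> array_cells A = M"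
proof -
  obtain A where "filling n A \<and> array_cells A = M" using filling_exists[OF assms] by blast
  then obtain B where "filling n B \<and> array_cells B = M"
    "\<And>C. filling n C \<and> array_cells C = M \<Longrightarrow> ncols B \<le> ncols C"
    using ex_has_least_nat[of "\<lambda>A. filling n A \<and> array_cells A = M" A ncols] by blast
  then show ?thesis by (auto simp: ptableau_array_def)
qed

text \<open>Minimality forces equal widths on two arrays with the same cells, and then they have a
  common left-justified form.\<close>

lemma row_equiv_iff:
  "(A, B) \<in> row_equiv n \<longleftrightarrow>
     ptableau_array n A \<and> ptableau_array n B \<and> array_cells A = array_cells B"
proof
  assume "(A, B) \<in> row_equiv n"
  then show "ptableau_array n A \<and> ptableau_array n B \<and> array_cells A = array_cells B"
    using swap_step_invariants by (auto simp: row_equiv_def ptableau_array_def)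
next
  assume AB: "ptableau_array n A \<and> ptableau_array n B \<and> array_cells A = array_cells B"
  then have "ncols A = ncols B" by (auto simp: ptableau_array_def intro: le_antisym)
  then show "(A, B) \<in> row_equiv n"
    using AB fillings_swap_connected by (auto simp: row_equiv_def ptableau_array_def)
qed

lemma ptableaux_iff:
  "T \<in> ptableaux n \<longleftrightarrow>
     (\<exists>M. valid n M \<and> T = {A. ptableau_array n A \<and> array_cells A = M})"
proof
  assume "T \<in> ptableaux n"
  then obtain A where A: "ptableau_array n A" "T = row_equiv n `` {A}"
    by (auto simp: ptableaux_def elim: quotientE)
  then have "T = {B. ptableau_array n B \<and> array_cells B = array_cells A}"
    by (auto simp: row_equiv_iff)
  then show "\<exists>M. valid n M \<and> T = {A. ptableau_array n A \<and> array_cells A = M}"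
    using A(1) array_cells_valid by (auto simp: ptableau_array_def)
next
  assume "\<exists>M. valid n M \<and> T = {A. ptableau_array n A \<and> array_cells A = M}"
  then obtain M where M: "valid n M" "T = {A. ptableau_array n A \<and> array_cells A = M}" by blast
  obtain A where A: "ptableau_array n A" "array_cells A = M" using ptableau_array_exists[OF M(1)] by blast
  then have "T = row_equiv n `` {A}" using M(2) by (auto simp: row_equiv_iff)
  then show "T \<in> ptableaux n" using A(1) by (auto simp: ptableaux_def intro: quotientI)
qed

lemma cells_array_class:
  assumes "valid n M"
  shows "cells {A. ptableau_array n A \<and> array_cells A = M} = M"
proof -
  obtain A where A: "ptableau_array n A" "array_cells A = M" using ptableau_array_exists[OF assms] by blast
  then have "array_cells ` {A. ptableau_array n A \<and> array_cells A = M} = {M}" by auto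
  then show ?thesis by (simp add: cells_def)
qed

lemma ptableau_of_cells_eq:
  assumes "valid n M"
  shows "ptableau_of_cells n M = {A. ptableau_array n A \<and> array_cells A = M}"
  unfolding ptableau_of_cells_def
proof (rule the_equality)
  show "{A. ptableau_array n A \<and> array_cells A = M} \<in> ptableaux n \<and>
      cells {A. ptableau_array n A \<and> array_cells A = M} = M"
    using assms ptableaux_iff cells_array_class by blast
next
  fix T assume T: "T \<in> ptableaux n \<and> cells T = M"
  then obtain M' where M': "valid n M'" "T = {A. ptableau_array n A \<and> array_cells A = M'}"
    using ptableaux_iff by blast
  then show "T = {A. ptableau_array n A \<and> array_cells A = M}"
    using T cells_array_class[OF M'(1)] by simp
qed

lemma ptableau_of_cells_in: "valid n M \<Longrightarrow> ptableau_of_cells n M \<in> ptableaux n"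
  using ptableau_of_cells_eq ptableaux_iff by blast

lemma cells_ptableau_of_cells: "valid n M \<Longrightarrow> cells (ptableau_of_cells n M) = M"
  by (simp add: ptableau_of_cells_eq cells_array_class)

lemma valid_cells: "T \<in> ptableaux n \<Longrightarrow> valid n (cells T)"
  using ptableaux_iff cells_array_class by metis

lemma ptableau_of_cells_cells: "T \<in> ptableaux n \<Longrightarrow> ptableau_of_cells n (cells T) = T"
  using ptableaux_iff cells_array_class ptableau_of_cells_eq by metis

lemma ptableau_nonempty: "T \<in> ptableaux n \<Longrightarrow> T \<noteq> {}"
  using ptableaux_iff ptableau_array_exists by blast

lemma ptableau_arrays:
  assumes "T \<in> ptableaux n" "A \<in> T"
  shows "filling n A" "array_cells A = cells T"
  using assms ptableau_of_cells_eq[OF valid_cells[OF assms(1)]]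
  by (auto simp: ptableau_of_cells_cells ptableau_array_def)

section \<open>Two-row arrays and the crystal operators\<close>

lemma right_justified_successor:
  assumes R: "filling n R" "right_justified_form n A R" and b: "box R r c = Some j"
    and "Suc c \<le> ncols R"
  shows "\<exists>s\<le>r. \<exists>i\<ge>j. box R s (Suc c) = Some i"
proof (cases "box R r (Suc c)")
  case None
  then have "\<not> filling n (shift_cell R r c (Suc c))" using R b by (auto simp: right_justified_form_def)
  then obtain s i where "s < r" "box R s (Suc c) = Some i" "\<not> i < j"
    using filling_shift_right[OF R(1) b None \<open>Suc c \<le> ncols R\<close>] by blast
  then show ?thesis by (meson less_imp_le not_less)
next
  case (Some i)
  then show ?thesis using filling_row_mono[OF R(1) b Some] by auto
qed

lemma right_justified_successors:
  assumes R: "filling n R" "right_justified_form n A R" and b: "box R r c = Some j"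
    and "c \<le> d" "d \<le> ncols R"
  shows "\<exists>s\<le>r. \<exists>i\<ge>j. box R s d = Some i"
  using \<open>c \<le> d\<close> \<open>d \<le> ncols R\<close>
proof (induction d rule: dec_induct)
  case base
  then show ?case using b by blast
next
  case (step d)
  then obtain s i where s: "s \<le> r" "j \<le> i" "box R s d = Some i" by auto
  show ?case using right_justified_successor[OF R s(3) step.prems] s by (meson le_trans)
qed

section \<open>The passage to two rows\<close>

lemma nonblank_columns_nth:
  assumes A: "filling n A" and "cs = sorted_list_of_set (nonblank_columns i A)"
  shows "bij_betw (\<lambda>k. cs ! (k - 1)) {1..length cs} (nonblank_columns i A)"
    and "\<And>k l. 1 \<le> k \<Longrightarrow> l \<le> length cs \<Longrightarrow> k < l \<Longrightarrow> cs ! (k - 1) < cs ! (l - 1)"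
proof -
  have "nonblank_columns i A \<subseteq> {1..ncols A}"
    using filling_bounds[OF A] by (auto simp: nonblank_columns_def)
  then have fin: "finite (nonblank_columns i A)" by (rule finite_subset) simp
  then have cs: "set cs = nonblank_columns i A" "distinct cs" "sorted cs"
    using assms(2) by simp_all
  have "bij_betw (\<lambda>k. k - 1) {1..length cs} {..<length cs}"
    by (rule bij_betw_byWitness[where f' = Suc]) auto
  from bij_betw_trans[OF this bij_betw_nth[OF cs(2) refl refl]]
  show "bij_betw (\<lambda>k. cs ! (k - 1)) {1..length cs} (nonblank_columns i A)"
    unfolding cs(1) comp_def .
  have "sorted_wrt (<) cs" using cs by (simp add: strict_sorted_iff)
  then show "cs ! (k - 1) < cs ! (l - 1)" if "1 \<le> k" "l \<le> length cs" "k < l" for k l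
    using sorted_wrt_nth_less[of "(<)" cs "k - 1" "l - 1"] that by auto
qed

text \<open>Deleting blank columns renumbers the remaining ones in a strictly increasing way, so
  order constraints and counts survive.\<close>

lemma two_rows_cells:
  assumes A: "filling n A" and "1 \<le> i"
  shows "filling 2 (two_rows i A)"
    and "r = 1 \<or> r = 2 \<Longrightarrow> card {k. \<exists>u. box (two_rows i A) r k = Some u \<and> P u} =
      card {c. \<exists>u. box A (i + r - 1) c = Some u \<and> P u}"
proof -
  define cs where "cs = sorted_list_of_set (nonblank_columns i A)"
  define g where "g = (\<lambda>k. cs ! (k - 1))"
  have bij: "bij_betw g {1..length cs} (nonblank_columns i A)"
    and mono: "\<And>k l. 1 \<le> k \<Longrightarrow> l \<le> length cs \<Longrightarrow> k < l \<Longrightarrow> g k < g l"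
    using nonblank_columns_nth[OF A cs_def] unfolding g_def by auto
  have box: "box (two_rows i A) r k = Some j \<longleftrightarrow>
      (r = 1 \<or> r = 2) \<and> k \<in> {1..length cs} \<and> box A (i + r - 1) (g k) = Some j" for r k j
    by (auto simp: two_rows_def Let_def cs_def g_def)
  have nc: "ncols (two_rows i A) = length cs" by (simp add: two_rows_def Let_def cs_def)
  have "k < l" if "box (two_rows i A) r k = Some x" "box (two_rows i A) s l = Some y"
    "x \<le> y" "s \<le> r" "(x, r) \<noteq> (y, s)" for r k s l x y
  proof (rule ccontr)
    assume "\<not> k < l"
    then have "g l \<le> g k" using that mono[of l k] unfolding box by (cases "l = k") auto
    moreover have "g k < g l"
      using filling_less[OF A, of "i + r - 1" "g k" x "i + s - 1" "g l" y] that \<open>1 \<le> i\<close>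
      unfolding box by auto
    ultimately show False by simp
  qed
  moreover have "1 \<le> r \<and> r \<le> 2 \<and> 1 \<le> k \<and> k \<le> ncols (two_rows i A) \<and> 1 \<le> x"
    if "box (two_rows i A) r k = Some x" for r k x
    using that filling_bounds[OF A, of "i + r - 1" "g k" x] unfolding box nc by auto
  ultimately show "filling 2 (two_rows i A)" unfolding filling_iff by blast
  assume r: "r = 1 \<or> r = 2"
  let ?K = "{k. \<exists>u. box (two_rows i A) r k = Some u \<and> P u}"
  let ?C = "{c. \<exists>u. box A (i + r - 1) c = Some u \<and> P u}"
  have "?C \<subseteq> nonblank_columns i A" using r \<open>1 \<le> i\<close> by (auto simp: nonblank_columns_def)
  then have "?C \<subseteq> g ` {1..length cs}" using bij by (simp add: bij_betw_def)
  then have "?C = g ` ?K" unfolding box using r by blast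
  moreover have "inj_on g ?K"
    by (rule inj_on_subset[OF bij_betw_imp_inj_on[OF bij]]) (auto simp: box)
  ultimately show "card ?K = card ?C" by (simp add: card_image)
qed

lemma balance_array_cells:
  assumes "filling n A"
  shows "balance i (array_cells A) t = int (card {c. \<exists>u. box A (Suc i) c = Some u \<and> u \<le> t})
     - int (card {c. \<exists>u. box A i c = Some u \<and> u < t})"
  unfolding balance_def
  using size_filter_array_cells[OF assms, of "Suc i" "\<lambda>u. u \<le> t"]
    size_filter_array_cells[OF assms, of i "\<lambda>u. u < t"] by simp

lemma balance_two_rows:
  assumes "filling n A" "1 \<le> i"
  shows "balance 1 (array_cells (two_rows i A)) = balance i (array_cells A)"
proof
  fix t
  show "balance 1 (array_cells (two_rows i A)) t = balance i (array_cells A) t"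
    unfolding balance_array_cells[OF assms(1)] balance_array_cells[OF two_rows_cells(1)[OF assms]]
    using two_rows_cells(2)[OF assms, of 1 "\<lambda>u. u < t"] two_rows_cells(2)[OF assms, of 2 "\<lambda>u. u \<le> t"]
    by (simp add: numeral_2_eq_2)
qed

lemma raises_cong: "balance i M = balance k M' \<Longrightarrow> raises i M = raises k M'"
  by (simp add: raises_def fun_eq_iff)

lemma lowers_cong: "balance i M = balance k M' \<Longrightarrow> lowers i M = lowers k M'"
  by (simp add: lowers_def fun_eq_iff)

text \<open>The comparison \<open>card A - card C \<le> card A' - card C'\<close> of two balances,
  written without subtraction of naturals.\<close>

lemma card_diff_le:
  assumes "finite A'" "finite C'" "A \<subseteq> A'" "C \<subseteq> C'" "C' - C \<subseteq> A' - A"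
  shows "card A + card C' \<le> card A' + card C"
  using card_mono[OF _ assms(5)] assms(1-4) card_mono[OF assms(1,3)] card_mono[OF assms(2,4)]
  by (simp add: card_Diff_subset finite_subset)

lemma card_diff_less:
  assumes "finite A'" "finite C'" "A \<subseteq> A'" "C \<subseteq> C'" "C' - C \<subset> A' - A"
  shows "card A + card C' < card A' + card C"
  using psubset_card_mono[OF _ assms(5)] assms(1-4) card_mono[OF assms(1,3)] card_mono[OF assms(2,4)]
  by (simp add: card_Diff_subset finite_subset)

section \<open>The chosen cell of a justified form\<close>

definition raising_column :: "parray \<Rightarrow> nat \<Rightarrow> nat \<Rightarrow> bool" where
  "raising_column L k j \<longleftrightarrow> box L 2 k = Some j \<and> box L 1 k = None \<and>
     (\<forall>k'>k. box L 2 k' \<noteq> None \<longrightarrow> box L 1 k' \<noteq> None)"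

definition lowering_column :: "parray \<Rightarrow> nat \<Rightarrow> nat \<Rightarrow> bool" where
  "lowering_column R k j \<longleftrightarrow> box R 1 k = Some j \<and> box R 2 k = None \<and>
     (\<forall>k'<k. box R 1 k' \<noteq> None \<longrightarrow> box R 2 k' \<noteq> None)"

text \<open>A column with two cells matches them; the chosen cell is the last unmatched one of the
  lower row. Comparisons of balances thus reduce to inclusions between sets of columns.\<close>

lemma raising_column_raises:
  assumes L: "filling 2 L" "left_justified_form 2 A L" and k: "raising_column L k j"
  shows "raises 1 (array_cells L) j"
proof -
  have k2: "box L 2 k = Some j" and k1: "box L 1 k = None"
    and right: "\<And>c. k < c \<Longrightarrow> box L 2 c \<noteq> None \<Longrightarrow> box L 1 c \<noteq> None"
    using k by (auto simp: raising_column_def)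
  let ?B = "\<lambda>t. {c. \<exists>u. box L 2 c = Some u \<and> u \<le> t}"
  let ?X = "\<lambda>t. {c. \<exists>u. box L 1 c = Some u \<and> u < t}"
  have bal: "balance 1 (array_cells L) t = int (card (?B t)) - int (card (?X t))" for t
    using balance_array_cells[OF L(1), of 1 t] by (simp add: numeral_2_eq_2)
  have fin: "finite (?B t)" "finite (?X t)" for t by (rule filling_finite_row[OF L(1)])+
  have matched: "x < y" if "box L 1 c = Some x" "box L 2 c = Some y" for c x y
    using filling_less[OF L(1) that(2,1)] by force
  have rows: "s = 1 \<or> s = 2" if "box L s c = Some x" for s c x
    using filling_bounds[OF L(1) that] by auto
  have k0: "1 \<le> k" using filling_bounds[OF L(1) k2] by simp
  \<comment> \<open>An upper cell of content less than \<open>j\<close> at column \<open>k\<close>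
    or later would force such a content into column \<open>k\<close>, whose only cell is
    \<open>j\<close>.\<close>
  have left: "c < k" if x: "box L 1 c = Some x" "x < j" for c x
  proof (rule ccontr)
    assume "\<not> c < k"
    then obtain s i where si: "i \<le> x" "box L s k = Some i"
      using left_justified_predecessors[OF L x(1) k0] by auto
    then show False using rows[OF si(2)] k1 k2 x(2) by auto
  qed
  have "balance 1 (array_cells L) s < balance 1 (array_cells L) j" if s: "s < j" for s
  proof -
    \<comment> \<open>Upper contents from \<open>s\<close> up to below \<open>j\<close> lie left of
      \<open>k\<close>, where every column has a lower cell of content at most \<open>j\<close>; the
      match makes it exceed \<open>s\<close>. Column \<open>k\<close> itself makes the inclusion
      strict.\<close>
    have "c \<in> ?B j - ?B s \<and> c \<noteq> k" if c: "c \<in> ?X j - ?X s" for c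
    proof -
      obtain x where x: "box L 1 c = Some x" "x < j" "s \<le> x" using c by auto
      have "c < k" using left x by blast
      moreover have "1 \<le> c" using filling_bounds[OF L(1) x(1)] by simp
      ultimately obtain s' y where "2 \<le> s'" and y': "box L s' c = Some y" "y \<le> j"
        using left_justified_predecessors[OF L k2, of c] by auto
      then have y: "box L 2 c = Some y" using rows[OF y'(1)] by auto
      show ?thesis using y y' matched[OF x(1) y] x \<open>c < k\<close> by auto
    qed
    moreover have "k \<in> ?B j - ?B s" using k2 s by auto
    ultimately have "?X j - ?X s \<subset> ?B j - ?B s" by blast
    then have "card (?B s) + card (?X j) < card (?B j) + card (?X s)"
      using s by (intro card_diff_less fin) auto
    then show ?thesis unfolding bal by linarith
  qed
  moreover have "balance 1 (array_cells L) s \<le> balance 1 (array_cells L) j" if s: "j < s" for s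
  proof -
    \<comment> \<open>Lower contents above \<open>j\<close> lie right of \<open>k\<close>, where
      every lower cell is matched.\<close>
    have "c \<in> ?X s - ?X j" if c: "c \<in> ?B s - ?B j" for c
    proof -
      obtain y where y: "box L 2 c = Some y" "y \<le> s" "j < y" using c by auto
      have "k < c" using filling_row_mono[OF L(1) y(1) k2] y by force
      then obtain x where x: "box L 1 c = Some x" using right y by auto
      show ?thesis using x y matched[OF x y(1)] left[OF x] \<open>k < c\<close> by auto
    qed
    then have "card (?X j) + card (?B s) \<le> card (?X s) + card (?B j)"
      using s by (intro card_diff_le fin) auto
    then show ?thesis unfolding bal by linarith
  qed
  ultimately show ?thesis using filling_bounds[OF L(1) k2] by (simp add: raises_def)
qed

text \<open>If every lower cell were matched, those counted by the balance at \<open>j\<close> would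
  be cancelled by their partners. The balance there would be at most 0, its value at 0, although it
  has to be larger at a first argmax.\<close>

lemma raising_column_exists:
  assumes L: "filling 2 L" and j: "raises 1 (array_cells L) j"
  shows "\<exists>k i. raising_column L k i"
proof -
  let ?S = "{k. box L 2 k \<noteq> None \<and> box L 1 k = None}"
  let ?B = "{c. \<exists>u. box L 2 c = Some u \<and> u \<le> j}"
  let ?X = "{c. \<exists>u. box L 1 c = Some u \<and> u < j}"
  have "finite ?S" by (rule finite_subset[OF _ filling_finite_row[OF L, of 2 "\<lambda>_. True"]]) auto
  moreover have "?S \<noteq> {}"
  proof
    assume S: "?S = {}"
    have "?B \<subseteq> ?X"
    proof
      fix c assume "c \<in> ?B"
      then obtain y where y: "box L 2 c = Some y" "y \<le> j" by auto
      have "c \<notin> ?S" unfolding S by simp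
      then have "box L 1 c \<noteq> None" using y by simp
      then obtain x where x: "box L 1 c = Some x" by blast
      then show "c \<in> ?X" using filling_less[OF L y(1) x] y by force
    qed
    then have "card ?B \<le> card ?X" by (intro card_mono filling_finite_row[OF L])
    then have "balance 1 (array_cells L) j \<le> 0"
      using balance_array_cells[OF L, of 1 j] by (simp add: numeral_2_eq_2)
    moreover have "balance 1 (array_cells L) 0 < balance 1 (array_cells L) j"
      using j by (auto simp: raises_def)
    ultimately show False using balance_0[OF array_cells_valid[OF L], of 1] by linarith
  qed
  ultimately have "Max ?S \<in> ?S" "\<And>k. k \<in> ?S \<Longrightarrow> k \<le> Max ?S"
    by (rule Max_in, blast intro: Max_ge)
  then obtain i where "box L 2 (Max ?S) = Some i" "box L 1 (Max ?S) = None"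
    and max: "\<And>k. k \<in> ?S \<Longrightarrow> k \<le> Max ?S" by blast
  moreover have "box L 1 k \<noteq> None" if "Max ?S < k" "box L 2 k \<noteq> None" for k
    using max[of k] that by fastforce
  ultimately have "raising_column L (Max ?S) i" unfolding raising_column_def by blast
  then show ?thesis by blast
qed

lemma lowering_column_lowers:
  assumes R: "filling 2 R" "right_justified_form 2 A R" and k: "lowering_column R k j"
  shows "lowers 1 (array_cells R) j"
proof -
  have k1: "box R 1 k = Some j" and k2: "box R 2 k = None"
    and left: "\<And>c. c < k \<Longrightarrow> box R 1 c \<noteq> None \<Longrightarrow> box R 2 c \<noteq> None"
    using k by (auto simp: lowering_column_def)
  let ?B = "\<lambda>t. {c. \<exists>u. box R 2 c = Some u \<and> u \<le> t}"
  let ?X = "\<lambda>t. {c. \<exists>u. box R 1 c = Some u \<and> u < t}"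
  have bal: "balance 1 (array_cells R) t = int (card (?B t)) - int (card (?X t))" for t
    using balance_array_cells[OF R(1), of 1 t] by (simp add: numeral_2_eq_2)
  have fin: "finite (?B t)" "finite (?X t)" for t by (rule filling_finite_row[OF R(1)])+
  have matched: "x < y" if "box R 1 c = Some x" "box R 2 c = Some y" for c x y
    using filling_less[OF R(1) that(2,1)] by force
  have rows: "s = 1 \<or> s = 2" if "box R s c = Some x" for s c x
    using filling_bounds[OF R(1) that] by auto
  have kn: "k \<le> ncols R" using filling_bounds[OF R(1) k1] by simp
  have right: "k < c" if y: "box R 2 c = Some y" "j < y" for c y
  proof (rule ccontr)
    assume "\<not> k < c"
    then obtain s i where si: "y \<le> i" "box R s k = Some i"
      using right_justified_successors[OF R y(1) _ kn] by auto
    then show False using rows[OF si(2)] k1 k2 y(2) by auto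
  qed
  have "balance 1 (array_cells R) s \<le> balance 1 (array_cells R) j" if s: "s < j" for s
  proof -
    have "c \<in> ?B j - ?B s" if c: "c \<in> ?X j - ?X s" for c
    proof -
      obtain x where x: "box R 1 c = Some x" "x < j" "s \<le> x" using c by auto
      have "c < k" using filling_row_mono[OF R(1) k1 x(1)] x by force
      then obtain y where y: "box R 2 c = Some y" using left x by auto
      show ?thesis using x y matched[OF x(1) y] right[OF y] \<open>c < k\<close> by force
    qed
    then have "card (?B s) + card (?X j) \<le> card (?B j) + card (?X s)"
      using s by (intro card_diff_le fin) auto
    then show ?thesis unfolding bal by linarith
  qed
  moreover have "balance 1 (array_cells R) s < balance 1 (array_cells R) j" if s: "j < s" for s
  proof -
    have "c \<in> ?X s - ?X j \<and> c \<noteq> k" if c: "c \<in> ?B s - ?B j" for c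
    proof -
      obtain y where y: "box R 2 c = Some y" "y \<le> s" "j < y" using c by auto
      have "k < c" using right y by blast
      moreover have "c \<le> ncols R" using filling_bounds[OF R(1) y(1)] by simp
      ultimately obtain s' x where "s' \<le> 1" and x': "box R s' c = Some x" "j \<le> x"
        using right_justified_successors[OF R k1, of c] by auto
      then have x: "box R 1 c = Some x" using rows[OF x'(1)] by auto
      show ?thesis using x x' matched[OF x y(1)] y \<open>k < c\<close> by auto
    qed
    moreover have "k \<in> ?X s - ?X j" using k1 s by auto
    ultimately have "?B s - ?B j \<subset> ?X s - ?X j" by blast
    then have "card (?X j) + card (?B s) < card (?X s) + card (?B j)"
      using s by (intro card_diff_less fin) auto
    then show ?thesis unfolding bal by linarith
  qed
  ultimately show ?thesis by (simp add: lowers_def)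
qed

lemma lowering_column_exists:
  assumes R: "filling 2 R" and j: "lowers 1 (array_cells R) j"
  shows "\<exists>k i. lowering_column R k i"
proof -
  let ?S = "{k. box R 1 k \<noteq> None \<and> box R 2 k = None}"
  let ?B = "\<lambda>t. {c. \<exists>u. box R 2 c = Some u \<and> u \<le> t}"
  let ?X = "\<lambda>t. {c. \<exists>u. box R 1 c = Some u \<and> u < t}"
  have "\<exists>k. k \<in> ?S"
  proof (rule ccontr)
    assume S: "\<nexists>k. k \<in> ?S"
    \<comment> \<open>A place beyond \<open>j\<close> and all contents of the lower row, so that
      every partner of an upper cell is counted. Blank boxes contribute an unspecified
      \<open>the None\<close>, which can only enlarge \<open>s\<close>.\<close>
    define s where "s = Suc (j + Max ((\<lambda>c. the (box R 2 c)) ` {..ncols R}))"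
    have "y \<le> s" if "box R 2 c = Some y" for c y
    proof -
      have "y \<in> (\<lambda>c. the (box R 2 c)) ` {..ncols R}"
        using that filling_bounds[OF R that] by (intro image_eqI[of _ _ c]) auto
      then have "y \<le> Max ((\<lambda>c. the (box R 2 c)) ` {..ncols R})" by (intro Max_ge) auto
      then show ?thesis by (simp add: s_def)
    qed
    note bound = this
    have "c \<in> ?B s - ?B j" if c: "c \<in> ?X s - ?X j" for c
    proof -
      obtain x where x: "box R 1 c = Some x" "j \<le> x" using c by auto
      have "c \<notin> ?S" using S by blast
      then have "box R 2 c \<noteq> None" using x by simp
      then obtain y where y: "box R 2 c = Some y" by blast
      have "x < y" using filling_less[OF R y x(1)] by force
      then show ?thesis using x y bound[OF y] by auto
    qed
    then have "card (?B j) + card (?X s) \<le> card (?B s) + card (?X j)"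
      by (intro card_diff_le filling_finite_row[OF R]) (auto simp: s_def)
    then have "balance 1 (array_cells R) j \<le> balance 1 (array_cells R) s"
      using balance_array_cells[OF R, of 1] by (simp add: numeral_2_eq_2)
    moreover have "balance 1 (array_cells R) s < balance 1 (array_cells R) j"
      using j by (auto simp: lowers_def s_def)
    ultimately show False by linarith
  qed
  then obtain k where k: "k \<in> ?S" "\<And>c. c < k \<Longrightarrow> c \<notin> ?S"
    using exists_least_iff[of "\<lambda>k. k \<in> ?S"] by blast
  then obtain i where "box R 1 k = Some i" "box R 2 k = None" by blast
  moreover have "box R 2 c \<noteq> None" if "c < k" "box R 1 c \<noteq> None" for c
    using k(2)[OF that(1)] that(2) by fastforce
  ultimately have "lowering_column R k i" unfolding lowering_column_def by blast
  then show ?thesis by blast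
qed

text \<open>Every choice of array and justified form yields a content that satisfies
  \<open>raises\<close> for the same multiset, and \<open>raises\<close> has at most one solution;
  so the choices are immaterial.\<close>

lemma raising_content_iff:
  assumes T: "T \<in> ptableaux n" and "1 \<le> i"
  shows "raising_content i T j \<longleftrightarrow> raises i (cells T) j"
proof -
  have def: "raising_content i T j \<longleftrightarrow>
      (\<exists>A\<in>T. \<exists>L k. left_justified_form 2 (two_rows i A) L \<and> raising_column L k j)" for j
    by (simp add: raising_content_def raising_column_def)
  have L: "filling 2 L \<and> raises 1 (array_cells L) = raises i (cells T)"
    if A: "A \<in> T" and L: "left_justified_form 2 (two_rows i A) L" for A L
  proof -
    note A' = ptableau_arrays[OF T A]
    have "filling 2 L \<and> array_cells L = array_cells (two_rows i A)"
      using swap_step_invariants two_rows_cells(1)[OF A'(1) \<open>1 \<le> i\<close>] L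
      unfolding left_justified_form_def by blast
    then show ?thesis using balance_two_rows[OF A'(1) \<open>1 \<le> i\<close>] A'(2) raises_cong by metis
  qed
  have imp: "raising_content i T j \<Longrightarrow> raises i (cells T) j" for j
    unfolding def using L raising_column_raises by metis
  show ?thesis
  proof
    assume j: "raises i (cells T) j"
    obtain A where A: "A \<in> T" using ptableau_nonempty[OF T] by blast
    obtain L where L': "left_justified_form 2 (two_rows i A) L"
      using left_justified_exists two_rows_cells(1) ptableau_arrays(1)[OF T A] \<open>1 \<le> i\<close> by blast
    then obtain k j' where "raising_column L k j'"
      using L[OF A L'] j raising_column_exists by metis
    then have "raising_content i T j'" unfolding def using A L' by blast
    then show "raising_content i T j" using imp raises_unique[OF j] by blast
  qed (rule imp)
qed

lemma lowering_content_iff: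
  assumes T: "T \<in> ptableaux n" and "1 \<le> i"
  shows "lowering_content i T j \<longleftrightarrow> lowers i (cells T) j"
proof -
  have def: "lowering_content i T j \<longleftrightarrow>
      (\<exists>A\<in>T. \<exists>R k. right_justified_form 2 (two_rows i A) R \<and> lowering_column R k j)" for j
    by (simp add: lowering_content_def lowering_column_def)
  have R: "filling 2 R \<and> lowers 1 (array_cells R) = lowers i (cells T)"
    if A: "A \<in> T" and R: "right_justified_form 2 (two_rows i A) R" for A R
  proof -
    note A' = ptableau_arrays[OF T A]
    have "filling 2 R \<and> array_cells R = array_cells (two_rows i A)"
      using swap_step_invariants two_rows_cells(1)[OF A'(1) \<open>1 \<le> i\<close>] R
      unfolding right_justified_form_def by blast
    then show ?thesis using balance_two_rows[OF A'(1) \<open>1 \<le> i\<close>] A'(2) lowers_cong by metis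
  qed
  have imp: "lowering_content i T j \<Longrightarrow> lowers i (cells T) j" for j
    unfolding def using R lowering_column_lowers by metis
  show ?thesis
  proof
    assume j: "lowers i (cells T) j"
    obtain A where A: "A \<in> T" using ptableau_nonempty[OF T] by blast
    obtain R where R': "right_justified_form 2 (two_rows i A) R"
      using right_justified_exists two_rows_cells(1) ptableau_arrays(1)[OF T A] \<open>1 \<le> i\<close> by blast
    then obtain k j' where "lowering_column R k j'"
      using R[OF A R'] j lowering_column_exists by metis
    then have "lowering_content i T j'" unfolding def using A R' by blast
    then show "lowering_content i T j" using imp lowers_unique[OF j] by blast
  qed (rule imp)
qed

section \<open>Crystal operators as the relation \<open>up\<close>\<close>

lemma e_op_iff:
  assumes T: "T \<in> ptableaux n" and i: "1 \<le> i"
  shows "e_op n i T = Some U \<longleftrightarrow> U \<in> ptableaux n \<and> up i (cells T) (cells U)"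
proof -
  note val = valid_cells[OF T]
  have fn: "raising_content i T = raises i (cells T)" using raising_content_iff[OF assms] by blast
  have "e_op n i T = Some U \<longleftrightarrow>
      (\<exists>j. raises i (cells T) j \<and> U = ptableau_of_cells n (cells T - {#(j, Suc i)#} + {#(j, i)#}))"
  proof (cases "\<exists>j. raises i (cells T) j")
    case True
    then obtain j where j: "raises i (cells T) j" by blast
    then have "The (raises i (cells T)) = j" using raises_unique by (intro the_equality)
    then have "e_op n i T = Some (ptableau_of_cells n (cells T - {#(j, Suc i)#} + {#(j, i)#}))"
      using True by (simp add: e_op_def fn Let_def)
    then show ?thesis using j raises_unique[OF j] by (metis option.inject)
  next
    case False
    then show ?thesis by (simp add: e_op_def fn)
  qed
  also have "\<dots> \<longleftrightarrow> (\<exists>K. up i (cells T) K \<and> U = ptableau_of_cells n K)"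
    unfolding up_iff_raises by blast
  also have "\<dots> \<longleftrightarrow> U \<in> ptableaux n \<and> up i (cells T) (cells U)"
    using up_valid[OF _ val i] ptableau_of_cells_in cells_ptableau_of_cells ptableau_of_cells_cells
    by metis
  finally show ?thesis .
qed

lemma f_op_iff:
  assumes T: "T \<in> ptableaux n" and i: "1 \<le> i" "i < n"
  shows "f_op n i T = Some U \<longleftrightarrow> U \<in> ptableaux n \<and> up i (cells U) (cells T)"
proof -
  note val = valid_cells[OF T]
  have fn: "lowering_content i T = lowers i (cells T)" using lowering_content_iff[OF T i(1)] by blast
  have "f_op n i T = Some U \<longleftrightarrow>
      (\<exists>j. lowers i (cells T) j \<and> U = ptableau_of_cells n (cells T - {#(j, i)#} + {#(j, Suc i)#}))"
  proof (cases "\<exists>j. lowers i (cells T) j")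
    case True
    then obtain j where j: "lowers i (cells T) j" by blast
    then have "The (lowers i (cells T)) = j" using lowers_unique by (intro the_equality)
    then have "f_op n i T = Some (ptableau_of_cells n (cells T - {#(j, i)#} + {#(j, Suc i)#}))"
      using True by (simp add: f_op_def fn Let_def)
    then show ?thesis using j lowers_unique[OF j] by (metis option.inject)
  next
    case False
    then show ?thesis by (simp add: f_op_def fn)
  qed
  also have "\<dots> \<longleftrightarrow> (\<exists>K. up i K (cells T) \<and> U = ptableau_of_cells n K)"
    unfolding up_iff_lowers[OF val] by blast
  also have "\<dots> \<longleftrightarrow> U \<in> ptableaux n \<and> up i (cells U) (cells T)"
    using up_valid_back[OF _ val i(2)] ptableau_of_cells_in cells_ptableau_of_cells
      ptableau_of_cells_cells by metis
  finally show ?thesis .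
qed

section \<open>Plactic equivalence\<close>

lemma adjacent_iff:
  "crystal_edge n V W \<or> crystal_edge n W V \<longleftrightarrow>
     V \<in> ptableaux n \<and> (\<exists>i. 1 \<le> i \<and> i < n \<and> (f_op n i V = Some W \<or> e_op n i V = Some W))"
proof -
  have "W \<in> ptableaux n \<and> f_op n i W = Some V \<longleftrightarrow> V \<in> ptableaux n \<and> e_op n i V = Some W"
    if "1 \<le> i" "i < n" for i
    using that by (cases "V \<in> ptableaux n"; cases "W \<in> ptableaux n") (simp_all add: e_op_iff f_op_iff)
  then show ?thesis unfolding crystal_edge_def by blast
qed

lemma component_refl: "T \<in> component n T"
  by (simp add: component_def)

lemma component_step:
  assumes "U \<in> component n T" "U \<in> ptableaux n" "1 \<le> i" "i < n"
    "f_op n i U = Some W \<or> e_op n i U = Some W"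
  shows "W \<in> component n T"
  using assms adjacent_iff[of n U W] unfolding component_def
  by (auto intro: rtranclp.rtrancl_into_rtrancl)

lemma component_induct [consumes 1, case_names refl step]:
  assumes "U \<in> component n T" and "P T"
    and "\<And>V W i. P V \<Longrightarrow> V \<in> component n T \<Longrightarrow> V \<in> ptableaux n \<Longrightarrow> 1 \<le> i \<Longrightarrow> i < n \<Longrightarrow>
      f_op n i V = Some W \<or> e_op n i V = Some W \<Longrightarrow> P W"
  shows "P U"
proof -
  have "(\<lambda>V W. crystal_edge n V W \<or> crystal_edge n W V)\<^sup>*\<^sup>* T U"
    using assms(1) by (simp add: component_def)
  then show ?thesis
  proof (induction rule: rtranclp_induct)
    case base
    then show ?case using assms(2) .
  next
    case (step V W)
    then show ?case using assms(3)[of V _ W] adjacent_iff[of n V W] by (auto simp: component_def)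
  qed
qed

lemma component_ptableaux:
  assumes "U \<in> component n T" "T \<in> ptableaux n" shows "U \<in> ptableaux n"
  using assms(1)
proof (induction rule: component_induct)
  case (step V W i)
  then show ?case using e_op_iff f_op_iff by metis
qed (rule assms(2))

section \<open>Isomorphisms as bisimulations\<close>

text \<open>A partial isomorphism that is not tied to a pair of components:
  \<open>rel_option\<close> carries a related pair along all edges and makes both operators
  undefined at the same time.\<close>

definition bisimulation :: "nat \<Rightarrow> (ptableau \<Rightarrow> ptableau \<Rightarrow> bool) \<Rightarrow> bool" where
  "bisimulation n R \<longleftrightarrow> bi_unique R \<and>
     (\<forall>U V. R U V \<longrightarrow> U \<in> ptableaux n \<and> V \<in> ptableaux n \<and>
        (\<forall>r. 1 \<le> r \<and> r \<le> n \<longrightarrow> weight U r = weight V r) \<and>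
        (\<forall>i. 1 \<le> i \<and> i < n \<longrightarrow>
           rel_option R (e_op n i U) (e_op n i V) \<and> rel_option R (f_op n i U) (f_op n i V)))"

lemma bisimulation_eq: "bisimulation n (\<lambda>U V. U = V \<and> U \<in> ptableaux n)"
proof -
  have "rel_option (\<lambda>U V. U = V \<and> U \<in> ptableaux n) x x" if "\<And>U. x = Some U \<Longrightarrow> U \<in> ptableaux n"
    for x using that by (cases x) auto
  moreover have "W \<in> ptableaux n"
    if "U \<in> ptableaux n" "1 \<le> i" "i < n" "e_op n i U = Some W \<or> f_op n i U = Some W" for U W i
    using that by (auto simp: e_op_iff f_op_iff)
  ultimately show ?thesis by (auto simp: bisimulation_def bi_unique_def)
qed

lemma bisimulation_conversep: "bisimulation n R \<Longrightarrow> bisimulation n R\<inverse>\<inverse>"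
  unfolding bisimulation_def bi_unique_conversep option.rel_conversep by auto

lemma bisimulation_compp: "bisimulation n R \<Longrightarrow> bisimulation n S \<Longrightarrow> bisimulation n (R OO S)"
  unfolding bisimulation_def option.rel_compp by (auto intro: bi_unique_OO) (metis relcomppI)+

lemma bisimulation_component:
  assumes R: "bisimulation n R" "R T T'" and U: "U \<in> component n T"
  shows "\<exists>V \<in> component n T'. R U V"
  using U
proof (induction rule: component_induct)
  case refl
  then show ?case using R(2) component_refl by blast
next
  case (step U W i)
  then obtain V where V: "V \<in> component n T'" "R U V" by blast
  then have "V \<in> ptableaux n" "rel_option R (e_op n i U) (e_op n i V)"
    "rel_option R (f_op n i U) (f_op n i V)"
    using R(1) step.hyps by (auto simp: bisimulation_def)
  then have "\<exists>W'. (f_op n i V = Some W' \<or> e_op n i V = Some W') \<and> R W W'"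
    using step.hyps by (auto simp: option_rel_Some1)
  then obtain W' where "f_op n i V = Some W' \<or> e_op n i V = Some W'" "R W W'" by blast
  then show ?case using component_step[OF V(1) \<open>V \<in> ptableaux n\<close>] step.hyps by blast
qed

text \<open>The graph of an isomorphism on the component is a bisimulation. Conversely, a
  bisimulation and its converse both propagate along edges, so together they cover both components,
  and \<open>bi_unique\<close> makes the restriction a bijection.\<close>

lemma plactically_equivalent_iff:
  assumes "T \<in> ptableaux n" "T' \<in> ptableaux n"
  shows "plactically_equivalent n T T' \<longleftrightarrow> (\<exists>R. bisimulation n R \<and> R T T')"
proof
  assume "plactically_equivalent n T T'"
  then obtain \<phi> where iso: "crystal_iso n (component n T) (component n T') \<phi>" and \<phi>: "\<phi> T = T'"
    by (auto simp: plactically_equivalent_def)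
  define R where "R = (\<lambda>U V. U \<in> component n T \<and> V = \<phi> U)"
  have bij: "bij_betw \<phi> (component n T) (component n T')" using iso by (simp add: crystal_iso_def)
  have "bi_unique R"
    using bij_betw_imp_inj_on[OF bij] by (auto simp: R_def bi_unique_def inj_on_def)
  moreover have "rel_option R x (map_option \<phi> x)" if "\<And>W. x = Some W \<Longrightarrow> W \<in> component n T" for x
    using that by (cases x) (auto simp: R_def)
  moreover have "\<phi> U \<in> ptableaux n" "U \<in> ptableaux n" if "U \<in> component n T" for U
    using that assms component_ptableaux bij_betwE[OF bij] by auto
  ultimately have "bisimulation n R"
    using iso component_step[of _ n T] unfolding bisimulation_def crystal_iso_def
    by (auto simp: R_def)
  moreover have "R T T'" using \<phi> component_refl by (auto simp: R_def)
  ultimately show "\<exists>R. bisimulation n R \<and> R T T'" by blast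
next
  assume "\<exists>R. bisimulation n R \<and> R T T'"
  then obtain R where R: "bisimulation n R" "R T T'" by blast
  have uniq: "R U V \<Longrightarrow> R U V' \<Longrightarrow> V = V'" and uniq': "R U V \<Longrightarrow> R U' V \<Longrightarrow> U = U'" for U U' V V'
    using R(1) by (auto simp: bisimulation_def bi_unique_def)
  define \<phi> where "\<phi> U = (THE V. R U V)" for U
  have \<phi>: "\<phi> U = V" if "R U V" for U V using that uniq unfolding \<phi>_def by (intro the_equality)
  have fwd: "\<exists>V \<in> component n T'. R U V" if "U \<in> component n T" for U
    using bisimulation_component[OF R that] .
  have bwd: "\<exists>U \<in> component n T. R U V" if "V \<in> component n T'" for V
    using bisimulation_component[OF bisimulation_conversep[OF R(1)] _ that] R(2) by auto
  have "inj_on \<phi> (component n T)" by (rule inj_onI) (metis fwd \<phi> uniq')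
  moreover have "\<phi> ` component n T = component n T'"
    by (auto, metis fwd \<phi>, metis bwd \<phi> imageI)
  moreover have "x' = map_option \<phi> x" if "rel_option R x x'" for x x'
    using that \<phi> by (cases x; cases x') auto
  ultimately have "crystal_iso n (component n T) (component n T') \<phi>"
    using R(1) fwd \<phi> unfolding crystal_iso_def bij_betw_def bisimulation_def by metis
  then show "plactically_equivalent n T T'"
    using \<phi>[OF R(2)] by (auto simp: plactically_equivalent_def)
qed

lemma weight_row_size: "weight T r = row_size r (cells T)"
  by (simp add: weight_def row_size_def)

lemma valid_swapped_exists:
  assumes "valid n M" shows "\<exists>N. valid N (swapped M)"
proof
  have "a \<le> Max (fst ` set_mset M)" if "(a, b) \<in># M" for a b
    using that by (intro Max_ge) (auto intro: image_eqI[of _ _ "(a, b)"])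
  then show "valid (Max (fst ` set_mset M)) (swapped M)" using assms by (auto simp: valid_def)
qed

text \<open>The commuting squares supply related images; the equivalences about existence exclude
  that an operator is undefined at one of two related ptableaux only.\<close>

lemma bisimulation_column_step:
  assumes j: "1 \<le> j"
  shows "bisimulation n (\<lambda>U V. U \<in> ptableaux n \<and> V \<in> ptableaux n \<and>
     up j (swapped (cells U)) (swapped (cells V)))" (is "bisimulation n ?R")
proof -
  have cells_eq: "U = V" if "cells U = cells V" "U \<in> ptableaux n" "V \<in> ptableaux n" for U V
    using that ptableau_of_cells_cells by metis
  have "bi_unique ?R"
    unfolding bi_unique_def
  proof (intro conjI allI impI)
    fix U V V' assume "?R U V" "?R U V'"
    then show "V = V'" using up_functional cells_eq by (metis swapped_swapped)
  next
    fix U U' V assume *: "?R U V" "?R U' V"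
    then obtain N where "valid N (swapped (cells V))" using valid_swapped_exists valid_cells by blast
    then show "U = U'" using * up_injective cells_eq by (metis swapped_swapped)
  qed
  moreover have "weight U r = weight V r" if "?R U V" for U V r
    using that row_size_up_swapped[of j "cells U" "cells V" r] by (simp add: weight_row_size)
  moreover have "rel_option ?R (e_op n i U) (e_op n i V)" if UV: "?R U V" and i: "1 \<le> i" "i < n" for U V i
  proof (cases "e_op n i U")
    case None
    have "e_op n i V = None"
    proof (rule ccontr)
      assume "e_op n i V \<noteq> None"
      then have "\<exists>K. up i (cells V) K" using e_op_iff UV i by blast
      then obtain K where K: "up i (cells U) K"
        using up_swapped_ex_up[of j "cells U" "cells V" n i] UV valid_cells j by blast
      then have "valid n K" using up_valid UV valid_cells i by blast
      then have "e_op n i U = Some (ptableau_of_cells n K)"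
        using e_op_iff UV i K cells_ptableau_of_cells ptableau_of_cells_in by simp
      then show False using None by simp
    qed
    then show ?thesis using None by simp
  next
    case (Some W)
    then have W: "W \<in> ptableaux n" "up i (cells U) (cells W)" using e_op_iff UV i by auto
    then obtain K where K: "up i (cells V) K" "up j (swapped (cells W)) (swapped K)"
      using up_swapped_commute UV i j by blast
    then have "valid n K" using up_valid UV valid_cells i by blast
    then have "e_op n i V = Some (ptableau_of_cells n K)" "?R W (ptableau_of_cells n K)"
      using e_op_iff UV i K W cells_ptableau_of_cells ptableau_of_cells_in by simp_all
    then show ?thesis using Some by simp
  qed
  moreover have "rel_option ?R (f_op n i U) (f_op n i V)" if UV: "?R U V" and i: "1 \<le> i" "i < n" for U V i
  proof (cases "f_op n i U")
    case None
    have "f_op n i V = None"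
    proof (rule ccontr)
      assume "f_op n i V \<noteq> None"
      then have "\<exists>K. up i K (cells V)" using f_op_iff UV i by blast
      then obtain K where K: "up i K (cells U)"
        using up_swapped_ex_down[of j "cells U" "cells V" n i] UV valid_cells j by blast
      then have "valid n K" using up_valid_back UV valid_cells i by blast
      then have "f_op n i U = Some (ptableau_of_cells n K)"
        using f_op_iff UV i K cells_ptableau_of_cells ptableau_of_cells_in by simp
      then show False using None by simp
    qed
    then show ?thesis using None by simp
  next
    case (Some W)
    then have W: "W \<in> ptableaux n" "up i (cells W) (cells U)" using f_op_iff UV i by auto
    obtain N where "valid N (swapped (cells U))" using valid_swapped_exists valid_cells UV by blast
    then obtain K where K: "up i K (cells V)" "up j (swapped (cells W)) (swapped K)"
      using up_swapped_commute_down[of j "cells U" "cells V" i "cells W" n N] W UV i j valid_cells by blast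
    then have "valid n K" using up_valid_back UV valid_cells i by blast
    then have "f_op n i V = Some (ptableau_of_cells n K)" "?R W (ptableau_of_cells n K)"
      using f_op_iff UV i K W cells_ptableau_of_cells ptableau_of_cells_in by simp_all
    then show ?thesis using Some by simp
  qed
  ultimately show ?thesis unfolding bisimulation_def by blast
qed

section \<open>Column connectivity\<close>

text \<open>An edge of the crystal of the duals with \<open>N\<close> rows, read on the multisets
  before transposition.\<close>

definition column_step :: "nat \<Rightarrow> (nat \<times> nat) multiset \<Rightarrow> (nat \<times> nat) multiset \<Rightarrow> bool" where
  "column_step N X Y \<longleftrightarrow> (\<exists>j. 1 \<le> j \<and> j < N \<and> up j (swapped X) (swapped Y))"

definition column_connected :: "nat \<Rightarrow> (nat \<times> nat) multiset \<Rightarrow> (nat \<times> nat) multiset \<Rightarrow> bool" where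
  "column_connected N = (\<lambda>X Y. column_step N X Y \<or> column_step N Y X)\<^sup>*\<^sup>*"

lemma column_connected_sym: "column_connected N X Y \<Longrightarrow> column_connected N Y X"
  unfolding column_connected_def by (rule sympD[OF symp_rtranclp]) (auto simp: symp_def)

lemma column_connected_trans:
  "column_connected N X Y \<Longrightarrow> column_connected N Y Z \<Longrightarrow> column_connected N X Z"
  unfolding column_connected_def by simp

lemma column_step_valid:
  assumes "column_step N X Y"
  shows "valid n X \<longleftrightarrow> valid n Y" and "valid N (swapped X) \<longleftrightarrow> valid N (swapped Y)"
proof -
  obtain j where j: "1 \<le> j" "j < N" "up j (swapped X) (swapped Y)"
    using assms by (auto simp: column_step_def)
  show "valid n X \<longleftrightarrow> valid n Y" using up_valid_swapped[OF j(3,1), of n] by simp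
  show "valid N (swapped X) \<longleftrightarrow> valid N (swapped Y)"
    using up_valid[OF j(3)] up_valid_back[OF j(3)] j by blast
qed

lemma column_connected_valid:
  assumes "column_connected N X Y"
  shows "valid n X \<longleftrightarrow> valid n Y" and "valid N (swapped X) \<longleftrightarrow> valid N (swapped Y)"
  using assms unfolding column_connected_def
  by (induction rule: rtranclp_induct) (auto simp: column_step_valid)

text \<open>Used to pull a connection between raised elements back to the elements themselves. The
  commuting squares are pasted along the path.\<close>

lemma column_connected_down:
  assumes "column_connected N X X'" and "up i K X" and "valid n X" "valid N (swapped X)"
    and i: "1 \<le> i" "i < n"
  shows "\<exists>K'. up i K' X' \<and> column_connected N K K'"
  using assms(1) unfolding column_connected_def
proof (induction rule: rtranclp_induct)
  case base
  then show ?case using assms(2) by blast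
next
  case (step Y Z)
  then obtain K1 where K1: "up i K1 Y" "column_connected N K K1" by (auto simp: column_connected_def)
  have Y: "valid n Y" "valid N (swapped Y)"
    using column_connected_valid[of N X Y] step.hyps(1) assms(3,4) by (auto simp: column_connected_def)
  have Z: "valid n Z" "valid N (swapped Z)" using step.hyps(2) Y column_step_valid by blast+
  have "\<exists>K'. up i K' Z \<and> (column_step N K1 K' \<or> column_step N K' K1)"
    using step.hyps(2)
  proof
    assume "column_step N Y Z"
    then show ?thesis using up_swapped_commute_down[OF _ K1(1) i(1) _ Y i(2)]
      unfolding column_step_def by blast
  next
    assume "column_step N Z Y"
    then obtain j where j: "1 \<le> j" "j < N" "up j (swapped Z) (swapped Y)" by (auto simp: column_step_def)
    \<comment> \<open>Against the direction of a column step, the lowered element is first found by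
      the existence equivalence; the square over it ends at \<open>K1\<close> by
      injectivity.\<close>
    obtain K' where K': "up i K' Z" using up_swapped_ex_down[OF j(3) Z(1) j(1)] K1 by blast
    then obtain K2 where "up i K2 Y" "up j (swapped K') (swapped K2)"
      using up_swapped_commute_down[OF j(3) K' i(1) j(1) Z i(2)] by blast
    then have "up j (swapped K') (swapped K1)" using up_injective[OF Y(1)] K1 by blast
    then show ?thesis using K' j by (auto simp: column_step_def)
  qed
  then show ?case using K1(2) by (auto simp: column_connected_def intro: rtranclp.rtrancl_into_rtrancl)
qed

section \<open>Highest weight elements\<close>

definition highest :: "nat \<Rightarrow> (nat \<times> nat) multiset \<Rightarrow> bool" where
  "highest n M \<longleftrightarrow> (\<forall>i. 1 \<le> i \<and> i < n \<longrightarrow> (\<nexists>K. up i M K))"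

text \<open>The potential for raising: one cell moves up by one row.\<close>

lemma up_row_sum_less: "up i M K \<Longrightarrow> \<Sum>\<^sub># (image_mset snd K) < \<Sum>\<^sub># (image_mset snd M)"
  by (auto simp: up_def)

text \<open>By induction row \<open>r\<close> has no content less than \<open>r\<close>. The balance
  at \<open>r\<close> thus counts only the cells of row \<open>Suc r\<close> with content at most
  \<open>r\<close>, and a positive value would allow raising.\<close>

lemma highest_triangular:
  assumes h: "highest n M" and M: "valid n M" and "t < r"
  shows "count M (t, r) = 0"
  using \<open>t < r\<close>
proof (induction r arbitrary: t)
  case (Suc r)
  have no: "(t, s) \<notin># M" if "t = 0 \<or> n < s" for s using M that by (auto simp: valid_def)
  show ?case
  proof (cases "r = 0 \<or> n \<le> r")
    case True
    then have "(t, Suc r) \<notin># M" using no[of "Suc r"] Suc.prems by auto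
    then show ?thesis by (simp add: not_in_iff)
  next
    case False
    then have "balance r M r \<le> 0" using h ex_up_iff[OF M, of r] unfolding highest_def
      by (metis One_nat_def Suc_le_eq neq0_conv not_le)
    moreover have "{#p \<in># M. snd p = r \<and> fst p < r#} = {#}"
      using Suc.IH by (fastforce simp: count_eq_zero_iff)
    ultimately have "{#p \<in># M. snd p = Suc r \<and> fst p \<le> r#} = {#}" by (simp add: balance_def)
    then have "(t, Suc r) \<notin># M" using Suc.prems by auto
    then show ?thesis by (simp add: not_in_iff)
  qed
qed simp

lemma doubly_highest_diagonal:
  assumes "highest n M" "valid n M" "highest N (swapped M)" "valid N (swapped M)"
  shows "count M (t, r) = (if t = r then row_size r M else 0)"
proof -
  have off: "count M (t, r) = 0" if "t \<noteq> r" for t r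
    using that highest_triangular[OF assms(1,2), of t r] highest_triangular[OF assms(3,4), of r t]
    by (cases "t < r") auto
  have "{#p \<in># M. snd p = r#} = {#p \<in># M. p = (r, r)#}"
    using off by (intro filter_mset_cong) (auto simp: prod_eq_iff, metis not_in_iff surjective_pairing)
  then have "row_size r M = count M (r, r)" by (simp add: row_size_def count_eq_size)
  then show ?thesis using off by simp
qed

lemma doubly_highest_unique:
  assumes "highest n M" "valid n M" "highest N (swapped M)" "valid N (swapped M)"
    and "highest n K" "valid n K" "highest N (swapped K)" "valid N (swapped K)"
    and size: "\<And>r. 1 \<le> r \<Longrightarrow> r \<le> n \<Longrightarrow> row_size r M = row_size r K"
  shows "M = K"
proof (rule multiset_eqI)
  fix p :: "nat \<times> nat"
  obtain t r where p: "p = (t, r)" by (cases p)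
  show "count M p = count K p"
  proof (cases "1 \<le> r \<and> r \<le> n")
    case True
    then show ?thesis
      unfolding p using size doubly_highest_diagonal[OF assms(1-4)] doubly_highest_diagonal[OF assms(5-8)]
      by simp
  next
    case False
    then have "p \<notin># M" "p \<notin># K" using assms(2,6) unfolding p valid_def by auto
    then show ?thesis by (simp add: not_in_iff)
  qed
qed

lemma highest_column_step:
  assumes "column_step N X Y" "valid n X" shows "highest n X \<longleftrightarrow> highest n Y"
  using assms up_swapped_ex_up[of _ X Y n] unfolding column_step_def highest_def by blast

text \<open>Column raisings affect neither the existence of row raisings nor the row sizes, so the
  weight of \<open>M\<close> is still visible at the end.\<close>

lemma highest_column_connected:
  assumes "highest n M" "valid n M" "valid N (swapped M)"
  shows "\<exists>D. column_connected N M D \<and> highest n D \<and> highest N (swapped D) \<and>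
    (\<forall>r. row_size r D = row_size r M)"
  using assms
proof (induction "\<Sum>\<^sub># (image_mset snd (swapped M))" arbitrary: M rule: less_induct)
  case less
  show ?case
  proof (cases "highest N (swapped M)")
    case True
    then show ?thesis using less.prems by (auto simp: column_connected_def)
  next
    case False
    then obtain j K where j: "1 \<le> j" "j < N" "up j (swapped M) (swapped K)"
      unfolding highest_def by (metis swapped_swapped)
    then have step: "column_step N M K" by (auto simp: column_step_def)
    obtain D where D: "column_connected N K D" "highest n D" "highest N (swapped D)"
      "\<forall>r. row_size r D = row_size r K"
      using less.hyps[of K] up_row_sum_less[OF j(3)] highest_column_step[OF step]
        column_step_valid[OF step] less.prems by blast
    have "column_connected N M D" using D(1) step
      by (auto simp: column_connected_def intro: converse_rtranclp_into_rtranclp)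
    then show ?thesis using D row_size_up_swapped[OF j(3)] by auto
  qed
qed

text \<open>The raising path is taken one step at a time: \<open>R\<close> copies the step at
  \<open>T'\<close>, the raised elements are connected by induction, and the connection is pulled
  back.\<close>

lemma bisimulation_column_connected:
  assumes R: "bisimulation n R"
  shows "R T T' \<Longrightarrow> valid N (swapped (cells T)) \<Longrightarrow> valid N (swapped (cells T')) \<Longrightarrow>
     column_connected N (cells T) (cells T')"
proof (induction "\<Sum>\<^sub># (image_mset snd (cells T))" arbitrary: T T' rule: less_induct)
  case less
  have T: "T \<in> ptableaux n" "T' \<in> ptableaux n"
    and weights: "\<And>r. 1 \<le> r \<Longrightarrow> r \<le> n \<Longrightarrow> weight T r = weight T' r"
    and e: "\<And>i. 1 \<le> i \<Longrightarrow> i < n \<Longrightarrow> rel_option R (e_op n i T) (e_op n i T')"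
    using R less.prems(1) by (auto simp: bisimulation_def)
  note val = valid_cells[OF T(1)] valid_cells[OF T(2)]
  show ?case
  proof (cases "\<exists>i U. 1 \<le> i \<and> i < n \<and> e_op n i T = Some U")
    case True
    then obtain i U where i: "1 \<le> i" "i < n" and U: "e_op n i T = Some U" by blast
    obtain U' where U': "e_op n i T' = Some U'" "R U U'"
      using e[OF i] U by (auto simp: option_rel_Some1)
    have up: "up i (cells T) (cells U)" "up i (cells T') (cells U')" "U \<in> ptableaux n"
      using U U'(1) e_op_iff T i by auto
    then have vU: "valid N (swapped (cells U))" "valid N (swapped (cells U'))"
      using up_valid_swapped i(1) less.prems by blast+
    then have "column_connected N (cells U) (cells U')"
      using less.hyps[OF up_row_sum_less[OF up(1)] U'(2)] by blast
    then obtain K where K: "up i K (cells U')" "column_connected N (cells T) K"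
      using column_connected_down[OF _ up(1) valid_cells[OF up(3)] vU(1) i] by blast
    have "valid n (cells U')" using up_valid[OF up(2) val(2) i(1)] .
    \<comment> \<open>The pulled-back connection ends at some element below \<open>U'\<close> for
      the operator \<open>i\<close>, and there is only one.\<close>
    then have "K = cells T'" using up_injective K(1) up(2) by blast
    then show ?thesis using K(2) by simp
  next
    case False
    then have none: "e_op n i T = None" "e_op n i T' = None" if "1 \<le> i" "i < n" for i
      using e[OF that] that by (cases "e_op n i T"; auto)+
    have high: "highest n (cells S)" if S: "S \<in> ptableaux n" "\<And>i. 1 \<le> i \<Longrightarrow> i < n \<Longrightarrow> e_op n i S = None" for S
      unfolding highest_def
    proof (intro allI impI notI)
      fix i assume i: "1 \<le> i \<and> i < n" and "\<exists>K. up i (cells S) K"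
      then obtain K where K: "up i (cells S) K" by blast
      then have "valid n K" using up_valid valid_cells[OF S(1)] i by blast
      then have "e_op n i S = Some (ptableau_of_cells n K)"
        using e_op_iff S(1) i K cells_ptableau_of_cells ptableau_of_cells_in by simp
      then show False using S(2) i by simp
    qed
    obtain D where D: "column_connected N (cells T) D" "highest n D" "highest N (swapped D)"
      "\<forall>r. row_size r D = row_size r (cells T)"
      using highest_column_connected[OF high[OF T(1) none(1)] val(1) less.prems(2)] by blast
    obtain D' where D': "column_connected N (cells T') D'" "highest n D'" "highest N (swapped D')"
      "\<forall>r. row_size r D' = row_size r (cells T')"
      using highest_column_connected[OF high[OF T(2) none(2)] val(2) less.prems(3)] by blast
    have "D = D'"
    proof (rule doubly_highest_unique[of n D N D'])
      \<comment> \<open>\<open>R\<close> keeps the weight, and raising columns keeps the row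
        sizes.\<close>
      show "row_size r D = row_size r D'" if "1 \<le> r" "r \<le> n" for r
        using weights[OF that] D(4) D'(4) by (simp add: weight_row_size)
    qed (use D D' val less.prems column_connected_valid in blast)+
    then show ?thesis using D(1) D'(1) column_connected_sym column_connected_trans by blast
  qed
qed

text \<open>One bisimulation per column step, composed along the path; a step taken backwards
  contributes the converse relation.\<close>

lemma column_connected_bisimulation:
  assumes "column_connected N X Y" and "valid n X"
  shows "\<exists>R. bisimulation n R \<and> R (ptableau_of_cells n X) (ptableau_of_cells n Y)"
  using assms(1) unfolding column_connected_def
proof (induction rule: rtranclp_induct)
  case base
  then show ?case
    using bisimulation_eq[of n] ptableau_of_cells_in[OF assms(2)]
    by (intro exI[of _ "\<lambda>U V. U = V \<and> U \<in> ptableaux n"]) simp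
next
  case (step Y Z)
  then obtain R where R: "bisimulation n R" "R (ptableau_of_cells n X) (ptableau_of_cells n Y)" by blast
  have Y: "valid n Y"
    using column_connected_valid(1)[of N X Y] step.hyps(1) assms(2) by (auto simp: column_connected_def)
  then have Z: "valid n Z" using step.hyps(2) column_step_valid(1) by blast
  have one: "\<exists>S. bisimulation n S \<and> S (ptableau_of_cells n A) (ptableau_of_cells n B)"
    if AB: "column_step N A B" "valid n A" "valid n B" for A B
  proof -
    obtain j where "1 \<le> j" "up j (swapped A) (swapped B)" using AB by (auto simp: column_step_def)
    then show ?thesis
      using bisimulation_column_step[of j n] AB ptableau_of_cells_in cells_ptableau_of_cells
      by (intro exI[of _ "\<lambda>U V. U \<in> ptableaux n \<and> V \<in> ptableaux n \<and>
        up j (swapped (cells U)) (swapped (cells V))"]) simp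
  qed
  have "\<exists>S. bisimulation n S \<and> S (ptableau_of_cells n Y) (ptableau_of_cells n Z)"
    using step.hyps(2) one[OF _ Y Z] one[OF _ Z Y] bisimulation_conversep by (metis conversepI)
  then show ?case using R bisimulation_compp by (metis relcomppI)
qed

section \<open>Components of the duals\<close>

lemma component_sym: "U \<in> component n T \<Longrightarrow> T \<in> component n U"
  unfolding component_def mem_Collect_eq by (rule sympD[OF symp_rtranclp]) (auto simp: symp_def)

lemma component_trans: "U \<in> component n T \<Longrightarrow> V \<in> component n U \<Longrightarrow> V \<in> component n T"
  unfolding component_def mem_Collect_eq by (rule rtranclp_trans)

lemma same_irreducible_iff:
  assumes "T \<in> ptableaux n"
  shows "(\<exists>C \<in> irreducible_crystals n. T \<in> C \<and> U \<in> C) \<longleftrightarrow> U \<in> component n T"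
proof
  assume "\<exists>C \<in> irreducible_crystals n. T \<in> C \<and> U \<in> C"
  then obtain V where V: "T \<in> component n V" "U \<in> component n V" by (auto simp: irreducible_crystals_def)
  show "U \<in> component n T" by (rule component_trans[OF component_sym[OF V(1)] V(2)])
next
  assume "U \<in> component n T"
  then show "\<exists>C \<in> irreducible_crystals n. T \<in> C \<and> U \<in> C"
    using assms component_refl by (auto simp: irreducible_crystals_def)
qed

lemma component_iff_column_connected:
  assumes T: "T \<in> ptableaux N" and U: "U \<in> ptableaux N"
  shows "U \<in> component N T \<longleftrightarrow> column_connected N (swapped (cells T)) (swapped (cells U))"
proof
  assume "U \<in> component N T"
  then show "column_connected N (swapped (cells T)) (swapped (cells U))"
  proof (induction rule: component_induct)
    case (step V W i)
    then have "column_step N (swapped (cells V)) (swapped (cells W)) \<or>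
        column_step N (swapped (cells W)) (swapped (cells V))"
      using e_op_iff f_op_iff by (auto simp: column_step_def)
    with step.IH show ?case
      unfolding column_connected_def by (rule rtranclp.rtrancl_into_rtrancl)
  qed (simp add: column_connected_def)
next
  \<comment> \<open>Intermediate multisets of the path are not given as ptableaux, so the induction
    speaks about multisets \<open>Y\<close>.\<close>
  have "ptableau_of_cells N (swapped Y) \<in> component N T"
    if "column_connected N (swapped (cells T)) Y" for Y
    using that unfolding column_connected_def
  proof (induction rule: rtranclp_induct)
    case base
    then show ?case using component_refl ptableau_of_cells_cells[OF T] by simp
  next
    case (step Y Z)
    have Y: "valid N (swapped Y)"
      using column_connected_valid(2)[of N "swapped (cells T)" Y] step.hyps(1) valid_cells[OF T]
      by (auto simp: column_connected_def)
    then have Z: "valid N (swapped Z)" using step.hyps(2) column_step_valid(2) by blast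
    obtain i where i: "1 \<le> i" "i < N" "up i (swapped Y) (swapped Z) \<or> up i (swapped Z) (swapped Y)"
      using step.hyps(2) by (auto simp: column_step_def)
    then have "f_op N i (ptableau_of_cells N (swapped Y)) = Some (ptableau_of_cells N (swapped Z)) \<or>
        e_op N i (ptableau_of_cells N (swapped Y)) = Some (ptableau_of_cells N (swapped Z))"
      using e_op_iff f_op_iff Y Z ptableau_of_cells_in cells_ptableau_of_cells by auto
    then show ?case using component_step[OF step.IH ptableau_of_cells_in[OF Y] i(1,2)] by blast
  qed
  moreover assume "column_connected N (swapped (cells T)) (swapped (cells U))"
  ultimately show "U \<in> component N T" using ptableau_of_cells_cells[OF U] by force
qed

theorem theorem4p5:
  fixes n N :: nat and T T' :: ptableau
  assumes "T \<in> ptableaux n" and "T' \<in> ptableaux n"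
    and "\<forall>j \<in> contents T \<union> contents T'. j \<le> N"
  shows "plactically_equivalent n T T' \<longleftrightarrow>
    (\<exists>C \<in> irreducible_crystals N. dual N T \<in> C \<and> dual N T' \<in> C)"
proof -
  \<comment> \<open>The bound on the contents becomes the bound on the rows of the transposed
    multisets.\<close>
  have "valid N (swapped (cells S))" if "S \<in> ptableaux n" "\<forall>j \<in> contents S. j \<le> N" for S
    using valid_cells[OF that(1)] that(2) by (auto simp: valid_def contents_def)
  then have valid: "valid N (swapped (cells T))" "valid N (swapped (cells T'))"
    using assms by auto
  then have dual: "dual N T \<in> ptableaux N" "dual N T' \<in> ptableaux N"
    "cells (dual N T) = swapped (cells T)" "cells (dual N T') = swapped (cells T')"
    unfolding dual_def by (simp_all only: ptableau_of_cells_in cells_ptableau_of_cells)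
  have "plactically_equivalent n T T' \<longleftrightarrow> column_connected N (cells T) (cells T')"
    unfolding plactically_equivalent_iff[OF assms(1,2)]
  proof
    show "column_connected N (cells T) (cells T')" if "\<exists>R. bisimulation n R \<and> R T T'"
      using that bisimulation_column_connected valid by blast
    show "\<exists>R. bisimulation n R \<and> R T T'" if "column_connected N (cells T) (cells T')"
      using column_connected_bisimulation[OF that valid_cells[OF assms(1)]]
      by (simp add: ptableau_of_cells_cells[OF assms(1)] ptableau_of_cells_cells[OF assms(2)])
  qed
  then show ?thesis
    unfolding same_irreducible_iff[OF dual(1)] component_iff_column_connected[OF dual(1,2)]
    by (simp add: dual(3,4))
qed

end
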